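(* Assume that the kernel function $\kappa$ satisfies $$\big(\kappa(\mathbf{a},\mathbf{b})-\kappa(\mathbf{c},\mathbf{d})\big)^2\le\eta\big(\|\mathbf{a}-\mathbf{c}\|_2^2+\|\mathbf{b}-\mathbf{d}\|_2^2\big),\qquad \mathbf{a},\mathbf{b},\mathbf{c},\mathbf{d}\in\mathbb{R}^p,$$ where $\eta$ is a constant depending on $\kappa$. Consider the data set $\mathbf{X}=[\mathbf{x}_1,\ldots,\mathbf{x}_n]\in\mathbb{R}^{p\times n}$ and the kernel matrix $\mathbf{K}\in\mathbb{R}^{n\times n}$ with entries $K_{ij}=\kappa(\mathbf{x}_i,\mathbf{x}_j)$. Let $\mathcal{S}^{opt}=\arg\min_{\mathcal{S}}E(\mathbf{X},\mathcal{S})$ denote the optimal partitioning of $\mathbf{X}$ into $m$ clusters. Generate a random sign matrix $\mathbf{H}\in\mathbb{R}^{p'\times p}$, whose entries are independent and each equal to $+1/\sqrt{p'}$ or $-1/\sqrt{p'}$ with probability $1/2$, with $p'=\mathcal{O}(m/\varepsilon^2)$ for some parameter $\varepsilon\in(0,1/3)$. The Randomized Clustered Nyström method computes $\widehat{\mathbf{X}}=\mathbf{H}\mathbf{X}\in\mathbb{R}^{p'\times n}$ and generates a set of $m$ landmark points $\mathbf{Z}=[\mathbf{z}_1,\ldots,\mathbf{z}_m]$ by partitioning $\widehat{\mathbf{X}}$ into $m$ clusters $\widehat{\mathcal{S}}^{opt}=\{\widehat{\mathcal{S}}^{opt}_1,\ldots,\widehat{\mathcal{S}}^{opt}_m\}$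 and taking the sample means of the original data points over these clusters, $$\mathbf{z}_j=\frac{1}{|\widehat{\mathcal{S}}_j^{opt}|}\sum_{\mathbf{x}_i\in\widehat{\mathcal{S}}_j^{opt}}\mathbf{x}_i,\qquad j=1,\ldots,m.$$ Assume that the partitioning $\widehat{\mathcal{S}}^{opt}$ of $\widehat{\mathbf{X}}$ leads to $E(\widehat{\mathbf{X}},\widehat{\mathcal{S}}^{opt})$ within a constant factor of the optimal value $\min_{\mathcal{S}}E(\widehat{\mathbf{X}},\mathcal{S})$. Given matrices $\mathbf{C}\in\mathbb{R}^{n\times m}$ and $\mathbf{W}\in\mathbb{R}^{m\times m}$ with entries $C_{ij}=\kappa(\mathbf{x}_i,\mathbf{z}_j)$ and $W_{ij}=\kappa(\mathbf{z}_i,\mathbf{z}_j)$, the Nyström approximation error is bounded, with probability at least $0.96$ over the randomness of $\mathbf{H}$, by $$\|\mathbf{K}-\mathbf{C}\mathbf{W}^{\dagger}\mathbf{C}^T\|_F\le\eta_1\sqrt{(2+\varepsilon)\,E(\mathbf{X},\mathcal{S}^{opt})}+\eta_2\,(2+\varepsilon)\,E(\mathbf{X},\mathcal{S}^{opt}),$$ where $\eta_1$ and $\eta_2$ are two positive constants.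
   Context: A kernel function on $\mathbb{R}^p$ is a function of the form $\kappa(\mathbf{x},\mathbf{y})=\langle\Phi(\mathbf{x}),\Phi(\mathbf{y})\rangle$ for a feature map $\Phi$, so its kernel matrices are symmetric positive semidefinite. An $m$-partition $\mathcal{S}=\{\mathcal{S}_1,\ldots,\mathcal{S}_m\}$ of a data set of $n$ points is a collection of $m$ disjoint nonempty sets (clusters) whose union is the whole data set; a partition of the columns of $\widehat{\mathbf{X}}=\mathbf{H}\mathbf{X}=[\mathbf{H}\mathbf{x}_1,\ldots,\mathbf{H}\mathbf{x}_n]$ is also regarded as a partition of the columns of $\mathbf{X}$, by identifying $\mathbf{H}\mathbf{x}_i$ with $\mathbf{x}_i$. For a data matrix $\mathbf{Y}=[\mathbf{y}_1,\ldots,\mathbf{y}_n]$ and an $m$-partition $\mathcal{S}$, the K-means objective is $E(\mathbf{Y},\mathcal{S})=\sum_{i=1}^n\|\mathbf{y}_i-\mu(\mathbf{y}_i)\|_2^2$, where $\mu(\mathbf{y}_i)$ is the centroid (sample mean) of the cluster to which $\mathbf{y}_i$ is assigned. Minima over $\mathcal{S}$ range over $m$-partitions. $\|\cdot\|_F$ is the Frobenius norm and $\mathbf{W}^{\dagger}$ is the pseudo-inverse of $\mathbf{W}$. *)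

theory Defs
  imports "HOL-Probability.Product_PMF" "HOL-Library.Disjoint_Sets" "Jordan_Normal_Form.Matrix"
begin

unbundle no vec_syntax and no inner_syntax

text \<open>
  Vectors and matrices have explicit natural-number dimensions, so that numeric constants
  can be quantified before the dimensions. Points of a data set are the columns of a matrix and are
  identified with their indices, so that a partition of the columns of \<open>H * X\<close> is literally also
  a partition of the columns of \<open>X\<close>. All indices start at 0.
\<close>

definition sq_norm_vec :: "real vec \<Rightarrow> real" where
  "sq_norm_vec v = scalar_prod v v"

definition frobenius_norm :: "real mat \<Rightarrow> real" where
  "frobenius_norm A = sqrt (\<Sum>i<dim_row A. \<Sum>j<dim_col A. (A $$ (i, j))\<^sup>2)"

text \<open>The Moore--Penrose pseudo-inverse, specified by the four Penrose equations.\<close>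

definition is_pseudo_inverse :: "real mat \<Rightarrow> real mat \<Rightarrow> bool" where
  "is_pseudo_inverse A B \<longleftrightarrow>
     B \<in> carrier_mat (dim_col A) (dim_row A) \<and>
     A * B * A = A \<and> B * A * B = B \<and>
     transpose_mat (A * B) = A * B \<and> transpose_mat (B * A) = B * A"

definition pseudo_inverse :: "real mat \<Rightarrow> real mat" where
  "pseudo_inverse A = (THE B. is_pseudo_inverse A B)"

definition is_feature_map ::
    "nat \<Rightarrow> (real vec \<Rightarrow> 'h :: real_inner) \<Rightarrow> (real vec \<Rightarrow> real vec \<Rightarrow> real) \<Rightarrow> bool" where
  "is_feature_map p \<Phi> \<kappa> \<longleftrightarrow>
     (\<forall>x\<in>carrier_vec p. \<forall>y\<in>carrier_vec p. \<kappa> x y = inner (\<Phi> x) (\<Phi> y))"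

definition kernel_matrix ::
    "(real vec \<Rightarrow> real vec \<Rightarrow> real) \<Rightarrow> real mat \<Rightarrow> real mat \<Rightarrow> real mat" where
  "kernel_matrix \<kappa> A B = mat (dim_col A) (dim_col B) (\<lambda>(i, j). \<kappa> (col A i) (col B j))"

definition m_partition :: "nat \<Rightarrow> nat \<Rightarrow> nat set set \<Rightarrow> bool" where
  "m_partition n m S \<longleftrightarrow> partition_on {..<n} S \<and> card S = m"

definition centroid :: "real mat \<Rightarrow> nat set \<Rightarrow> real vec" where
  "centroid Y C = vec (dim_row Y) (\<lambda>k. (\<Sum>i\<in>C. Y $$ (k, i)) / real (card C))"

definition cluster_of :: "nat set set \<Rightarrow> nat \<Rightarrow> nat set" where
  "cluster_of S i = (THE C. C \<in> S \<and> i \<in> C)"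

definition kmeans_objective :: "real mat \<Rightarrow> nat set set \<Rightarrow> real" where
  "kmeans_objective Y S =
     (\<Sum>i<dim_col Y. sq_norm_vec (col Y i - centroid Y (cluster_of S i)))"

text \<open>The clusters are given as a list, which fixes the numbering of the landmark points.\<close>

definition landmarks :: "real mat \<Rightarrow> nat set list \<Rightarrow> real mat" where
  "landmarks X L = mat_of_cols (dim_row X) (map (centroid X) L)"

definition nystroem_error ::
    "(real vec \<Rightarrow> real vec \<Rightarrow> real) \<Rightarrow> real mat \<Rightarrow> real mat \<Rightarrow> real" where
  "nystroem_error \<kappa> X Z =
     (let K = kernel_matrix \<kappa> X X; C = kernel_matrix \<kappa> X Z; W = kernel_matrix \<kappa> Z Z
      in frobenius_norm (K - C * pseudo_inverse W * transpose_mat C))"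

text \<open>
  The law of a \<open>p' \<times> p\<close> matrix with independent uniform entries in
  \<open>{1 / sqrt p', - 1 / sqrt p'}\<close>; the second argument of \<^const>\<open>Pi_pmf\<close> is the irrelevant
  value outside the index range.
\<close>

definition random_sign_matrix :: "nat \<Rightarrow> nat \<Rightarrow> real mat pmf" where
  "random_sign_matrix p' p =
     map_pmf (mat p' p)
       (Pi_pmf ({..<p'} \<times> {..<p}) 0
          (\<lambda>_. pmf_of_set {1 / sqrt (real p'), - 1 / sqrt (real p')}))"

end

theory Submission
  imports Defs "Jordan_Normal_Form.Determinant"
begin

text \<open>
  In feature space, the error matrix is the Gram matrix of the residuals of the feature vectors
  \<open>\<Phi> x\<^sub>i\<close> after orthogonal projection onto the span of the \<open>\<Phi> z\<^sub>j\<close>, so its Frobenius norm is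
  at most \<open>\<Sum>\<^sub>i \<parallel>\<Phi> x\<^sub>i - \<Phi> z\<^bsub>j(i)\<^esub>\<parallel>\<^sup>2\<close>, and the condition on \<open>\<kappa>\<close> bounds this by a multiple of
  the square root of the K-means objective of the partition that produced the landmarks.

  That objective exceeds the optimum by at most a constant factor as soon as
  \<open>\<parallel>H y\<parallel>\<^sup>2 \<ge> c \<parallel>y\<parallel>\<^sup>2\<close> on the span of the \<open>m\<close> optimal centroids, where \<open>c > 0\<close> may depend on \<open>p\<close>
  and \<open>m\<close> but not on \<open>p'\<close>. The lower bound comes from Gaussian elimination along the rows of \<open>H\<close>:
  each row is a usable pivot for the first vector of the current spanning list with probability at
  least 1/2, every \<open>m\<close> pivots exhaust the list once and contribute a fixed multiple of
  \<open>\<parallel>y\<parallel>\<^sup>2 / p'\<close>, and with probability at least 0.96 more than \<open>p' / 4\<close> rows are usable once \<open>p' \<ge> 28\<close>.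
\<close>

subsection \<open>Pseudo-inverses of symmetric matrices\<close>

text \<open>Padding with a zero row makes the system square with determinant 0, so a nonzero kernel
  vector exists.\<close>

lemma underdetermined_system_nontrivial_solution:
  fixes a :: "nat \<Rightarrow> nat \<Rightarrow> 'a :: field"
  shows "\<exists>c. (\<exists>j<Suc N. c j \<noteq> 0) \<and> (\<forall>i<N. (\<Sum>j<Suc N. a i j * c j) = 0)"
proof -
  let ?r = "\<lambda>i. vec (Suc N) (a i)"
  let ?A = "mat\<^sub>r (Suc N) (Suc N) (\<lambda>i. if i = N then 0\<^sub>v (Suc N) else ?r i)"
  have "det ?A = 0"
    by (rule det_row_0) auto
  moreover have A: "?A \<in> carrier_mat (Suc N) (Suc N)"
    by simp
  ultimately obtain v where v: "v \<in> carrier_vec (Suc N)" "v \<noteq> 0\<^sub>v (Suc N)"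
      "?A *\<^sub>v v = 0\<^sub>v (Suc N)"
    using det_0_iff_vec_prod_zero_field by blast
  have "\<exists>j<Suc N. v $ j \<noteq> 0"
    using v(1,2) by (auto simp: vec_eq_iff)
  moreover have "(\<Sum>j<Suc N. a i j * v $ j) = 0" if "i < N" for i
  proof -
    have "(?A *\<^sub>v v) $ i = (\<Sum>j<Suc N. a i j * v $ j)"
      using that v(1) by (auto simp: scalar_prod_def atLeast0LessThan
          simp del: sum.lessThan_Suc intro!: sum.cong)
    thus ?thesis
      using v(3) that by (simp del: sum.lessThan_Suc)
  qed
  ultimately show ?thesis
    by blast
qed

text \<open>Some nontrivial polynomial annihilates \<open>W\<close>. Since \<open>W * (W * Y) = 0\<close> implies \<open>W * Y = 0\<close> for
  symmetric \<open>W\<close>, its factors \<open>W\<close> can be cancelled down to one, which gives a polynomial \<open>q\<close> in \<open>W\<close>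
  with \<open>W * q * W = W\<close>; then \<open>q * W * q\<close> is the pseudo-inverse.\<close>

fun horner_mat :: "real mat \<Rightarrow> real list \<Rightarrow> real mat" where
  "horner_mat W [] = 0\<^sub>m (dim_row W) (dim_row W)"
| "horner_mat W (c # cs) = c \<cdot>\<^sub>m 1\<^sub>m (dim_row W) + W * horner_mat W cs"

context
  fixes W :: "real mat" and m :: nat
  assumes W: "W \<in> carrier_mat m m" and sym: "transpose_mat W = W"
begin

lemma horner_mat_carrier: "horner_mat W cs \<in> carrier_mat m m"
  using W by (induction cs) auto

lemma horner_mat_commute: "W * horner_mat W cs = horner_mat W cs * W"
proof (induction cs)
  case (Cons c cs)
  let ?h = "horner_mat W cs"
  have h: "?h \<in> carrier_mat m m"
    by (rule horner_mat_carrier)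
  have "W * horner_mat W (c # cs) = W * (c \<cdot>\<^sub>m 1\<^sub>m m) + W * (W * ?h)"
    using W h by (simp add: mult_add_distrib_mat[of _ m m _ m])
  also have "W * (c \<cdot>\<^sub>m 1\<^sub>m m) = (c \<cdot>\<^sub>m 1\<^sub>m m) * W"
    using W by (simp add: mult_smult_distrib[of _ m m _ m] mult_smult_assoc_mat[of _ m m _ m])
  also have "W * (W * ?h) = (W * ?h) * W"
    using assoc_mult_mat[OF W h W] by (simp only: Cons.IH)
  also have "(c \<cdot>\<^sub>m 1\<^sub>m m) * W + (W * ?h) * W = horner_mat W (c # cs) * W"
    using W h by (simp add: add_mult_distrib_mat[of _ m m _ _ m])
  finally show ?case .
qed (use W in auto)

lemma transpose_horner_mat: "transpose_mat (horner_mat W cs) = horner_mat W cs"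
proof (induction cs)
  case (Cons c cs)
  have h: "horner_mat W cs \<in> carrier_mat m m"
    by (rule horner_mat_carrier)
  have "transpose_mat (c \<cdot>\<^sub>m 1\<^sub>m m) = c \<cdot>\<^sub>m 1\<^sub>m m"
    by (auto simp: mat_eq_iff)
  thus ?case
    using W h Cons.IH sym horner_mat_commute[of cs]
    by (simp add: transpose_add[of _ m m] transpose_mult[of _ m m _ m])
qed (use W in \<open>auto simp: mat_eq_iff\<close>)

text \<open>The iterates of left multiplication are the powers of \<open>W\<close>. Entrywise the
  polynomial is linear in its coefficients, so an annihilating one comes from a linear
  system.\<close>

lemma horner_mat_index:
  assumes "i < m" "j < m"
  shows "horner_mat W cs $$ (i, j) = (\<Sum>t<length cs. ((\<lambda>Y. W * Y) ^^ t) (1\<^sub>m m) $$ (i, j) * cs ! t)"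
  using assms
proof (induction cs arbitrary: i j)
  case Nil
  thus ?case using W by simp
next
  case (Cons c cs)
  have P: "((\<lambda>Y. W * Y) ^^ t) (1\<^sub>m m) \<in> carrier_mat m m" for t
    using W by (induction t) auto
  have "(W * horner_mat W cs) $$ (i, j) = (\<Sum>k<m. W $$ (i, k) * horner_mat W cs $$ (k, j))"
    using W horner_mat_carrier[of cs] Cons.prems
    by (auto simp: scalar_prod_def atLeast0LessThan)
  also have "\<dots> = (\<Sum>k<m. W $$ (i, k) *
      (\<Sum>t<length cs. ((\<lambda>Y. W * Y) ^^ t) (1\<^sub>m m) $$ (k, j) * cs ! t))"
    using Cons by (intro sum.cong) auto
  also have "\<dots> = (\<Sum>t<length cs. (\<Sum>k<m. W $$ (i, k) * ((\<lambda>Y. W * Y) ^^ t) (1\<^sub>m m) $$ (k, j)) * cs ! t)"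
    by (simp add: sum_distrib_left sum_distrib_right mult.assoc) (rule sum.swap)
  also have "\<dots> = (\<Sum>t<length cs. ((\<lambda>Y. W * Y) ^^ Suc t) (1\<^sub>m m) $$ (i, j) * cs ! t)"
    using W P Cons.prems carrier_matD[OF P] by (intro sum.cong refl) (simp add: scalar_prod_def atLeast0LessThan)
  finally have "(W * horner_mat W cs) $$ (i, j) = \<dots>" .
  thus ?case
    using W horner_mat_carrier[of cs] Cons.prems
    by (simp add: sum.lessThan_Suc_shift del: sum.lessThan_Suc funpow.simps(2))
qed

text \<open>For \<open>Z = W * Y\<close>, symmetry gives \<open>Z^T Z = Y^T (W (W Y)) = 0\<close>,
  and the diagonal of \<open>Z^T Z\<close> holds the squared column norms of
  \<open>Z\<close>.\<close>

lemma cancel_sym_mat: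
  assumes Y: "Y \<in> carrier_mat m m" and 0: "W * (W * Y) = 0\<^sub>m m m"
  shows "W * Y = 0\<^sub>m m m"
proof -
  let ?Z = "W * Y"
  have Z: "?Z \<in> carrier_mat m m"
    using W Y by simp
  have "transpose_mat ?Z * ?Z = transpose_mat Y * (W * (W * Y))"
    using W Y sym by (simp add: transpose_mult[of _ m m _ m] assoc_mult_mat[of _ m m _ m _ m])
  also have "\<dots> = 0\<^sub>m m m"
    using Y by (simp add: 0)
  finally have ZZ: "transpose_mat ?Z * ?Z = 0\<^sub>m m m" .
  have "?Z $$ (i, j) = 0" if ij: "i < m" "j < m" for i j
  proof -
    have "(transpose_mat ?Z * ?Z) $$ (j, j) = (\<Sum>k<m. (?Z $$ (k, j))\<^sup>2)"
      using Z ij carrier_matD[OF Z] by (simp add: scalar_prod_def atLeast0LessThan power2_eq_square)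
    hence "(\<Sum>k<m. (?Z $$ (k, j))\<^sup>2) = 0"
      using ZZ ij by simp
    thus ?thesis
      using ij by (subst (asm) sum_nonneg_eq_0_iff) auto
  qed
  thus ?thesis
    using Z carrier_matD[OF Z] by (intro eq_matI) auto
qed

text \<open>If the constant coefficient is 0, one factor \<open>W\<close> cancels and the degree
  drops; otherwise dividing by it expresses \<open>W\<close> as \<open>W * q * W\<close>. The extra
  factor \<open>W\<close> in the premise lets it reproduce itself in the induction.\<close>

lemma horner_mat_zero_imp_inverse:
  assumes "W * horner_mat W cs = 0\<^sub>m m m" "\<exists>t<length cs. cs ! t \<noteq> 0"
  shows "\<exists>q\<in>carrier_mat m m. transpose_mat q = q \<and> W * q = q * W \<and> W * q * W = W"
  using assms
proof (induction cs)
  case (Cons c cs)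
  let ?h = "horner_mat W cs"
  have h: "?h \<in> carrier_mat m m"
    by (rule horner_mat_carrier)
  show ?case
  proof (cases "c = 0")
    case True
    have "(0::real) \<cdot>\<^sub>m 1\<^sub>m m + W * ?h = W * ?h"
      using W h by (intro eq_matI) auto
    hence "W * (W * ?h) = 0\<^sub>m m m"
      using Cons.prems(1) True W by simp
    hence "W * ?h = 0\<^sub>m m m"
      by (rule cancel_sym_mat[OF h])
    moreover have "\<exists>t<length cs. cs ! t \<noteq> 0"
      using Cons.prems(2) True by (auto simp: less_Suc_eq_0_disj nth_Cons')
    ultimately show ?thesis
      by (rule Cons.IH)
  next
    case False
    let ?q = "(- (1 / c)) \<cdot>\<^sub>m ?h"
    have q: "?q \<in> carrier_mat m m"
      using h by simp
    have "W * (c \<cdot>\<^sub>m 1\<^sub>m m + W * ?h) = c \<cdot>\<^sub>m W + W * (W * ?h)"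
      using W h by (simp add: mult_add_distrib_mat[of _ m m _ m] mult_smult_distrib[of _ m m _ m])
    hence *: "c \<cdot>\<^sub>m W + W * (W * ?h) = 0\<^sub>m m m"
      using Cons.prems(1) W by simp
    have "W $$ (i, j) = (- (1 / c)) * (W * (W * ?h)) $$ (i, j)" if "i < m" "j < m" for i j
    proof -
      have "(c \<cdot>\<^sub>m W + W * (W * ?h)) $$ (i, j) = 0"
        using that by (simp add: *)
      hence "c * W $$ (i, j) + (W * (W * ?h)) $$ (i, j) = 0"
        using that W h by simp
      thus ?thesis
        using False by (simp add: field_simps)
    qed
    hence "(- (1 / c)) \<cdot>\<^sub>m (W * (W * ?h)) = W"
      using W h by (intro eq_matI) auto
    moreover have "W * ?q * W = (- (1 / c)) \<cdot>\<^sub>m (W * (W * ?h))"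
      using W h assoc_mult_mat[OF W h W]
      by (simp add: mult_smult_distrib[of _ m m _ m] mult_smult_assoc_mat[of _ m m _ m]
          horner_mat_commute del: assoc_mult_mat)
    moreover have "W * ?q = ?q * W"
      using W h by (simp add: mult_smult_distrib[of _ m m _ m] mult_smult_assoc_mat[of _ m m _ m]
          horner_mat_commute)
    moreover have "transpose_mat ?q = ?q"
    proof -
      have "transpose_mat ?q = (- (1 / c)) \<cdot>\<^sub>m transpose_mat ?h"
        by (auto simp: mat_eq_iff)
      thus ?thesis
        by (simp add: transpose_horner_mat)
    qed
    ultimately show ?thesis
      using q by metis
  qed
qed simp

lemma sym_mat_inner_inverse:
  "\<exists>q\<in>carrier_mat m m. transpose_mat q = q \<and> W * q = q * W \<and> W * q * W = W"
proof -
  \<comment> \<open>The \<open>m * m + 1\<close> powers of \<open>W\<close> are dependent in a space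
    of dimension \<open>m * m\<close>; index \<open>i\<close> encodes the entry in row
    \<open>i div m\<close> and column \<open>i mod m\<close>.\<close>
  obtain c where c: "\<exists>t<Suc (m * m). c t \<noteq> 0"
    "\<And>i. i < m * m \<Longrightarrow> (\<Sum>t<Suc (m * m). ((\<lambda>Y. W * Y) ^^ t) (1\<^sub>m m) $$ (i div m, i mod m) * c t) = 0"
    using underdetermined_system_nontrivial_solution
      [of "m * m" "\<lambda>i t. ((\<lambda>Y. W * Y) ^^ t) (1\<^sub>m m) $$ (i div m, i mod m)"] by blast
  let ?cs = "map c [0..<Suc (m * m)]"
  have "horner_mat W ?cs $$ (i, j) = 0" if ij: "i < m" "j < m" for i j
  proof -
    have "i * m + j < m * m"
    proof -
      have "i * m + j < Suc i * m" using ij by simp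
      also have "\<dots> \<le> m * m" using ij by (intro mult_right_mono) auto
      finally show ?thesis .
    qed
    from c(2)[OF this] show ?thesis
      using ij by (simp add: horner_mat_index del: sum.lessThan_Suc upt_Suc)
  qed
  hence "horner_mat W ?cs = 0\<^sub>m m m"
    using horner_mat_carrier[of ?cs] carrier_matD[OF horner_mat_carrier[of ?cs]]
    by (intro eq_matI) auto
  hence "W * horner_mat W ?cs = 0\<^sub>m m m"
    using W by simp
  moreover have "\<exists>t<length ?cs. ?cs ! t \<noteq> 0"
    using c(1) by (auto simp del: upt_Suc)
  ultimately show ?thesis
    by (rule horner_mat_zero_imp_inverse)
qed

text \<open>Passing from \<open>q\<close> to \<open>q * W * q\<close> secures
  \<open>B * W * B = B\<close>. Both products with \<open>W\<close> collapse to
  \<open>W * q\<close>, which is symmetric because its factors are symmetric and commute.\<close>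

lemma sym_pseudo_inverse_exists: "\<exists>B. is_pseudo_inverse W B \<and> transpose_mat B = B"
proof -
  obtain q where q: "q \<in> carrier_mat m m" "transpose_mat q = q" "W * q = q * W" "W * q * W = W"
    using sym_mat_inner_inverse by blast
  let ?B = "q * W * q"
  note assoc = assoc_mult_mat[of _ m m _ m _ m]
  have B: "?B \<in> carrier_mat m m"
    using W q by simp
  have t: "transpose_mat (W * q) = W * q"
    using W q sym by (simp add: transpose_mult[of _ m m _ m])
  have WB: "W * ?B = W * q"
  proof -
    have "W * ?B = (W * q * W) * q"
      using W q(1) by (simp add: assoc)
    thus ?thesis by (simp add: q(4))
  qed
  have BW: "?B * W = W * q"
  proof -
    have "?B * W = q * (W * q * W)"
      using W q(1) by (simp add: assoc)
    thus ?thesis by (simp only: q(3)[symmetric] q(4))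
  qed
  have BWB: "?B * W * ?B = ?B"
  proof -
    have "?B * W * ?B = (W * q) * (q * W * q)"
      by (simp add: BW)
    also have "\<dots> = (q * W) * (q * W * q)"
      by (simp add: q(3))
    also have "\<dots> = q * (W * q * W) * q"
      using W q(1) by (simp add: assoc)
    finally show ?thesis by (simp add: q(4))
  qed
  have "transpose_mat ?B = ?B"
    using W q sym by (simp add: transpose_mult[of _ m m _ m] assoc)
  moreover have "is_pseudo_inverse W ?B"
    using B W t BWB by (simp add: is_pseudo_inverse_def WB BW q(4))
  ultimately show ?thesis by blast
qed

end

text \<open>Transposing \<open>(A * C) * (A * B)\<close> swaps its factors, so the Penrose equations
  give \<open>A * B = A * C\<close>, and likewise \<open>B * A = C * A\<close>; then
  \<open>B = B * A * B = B * A * C = C * A * C = C\<close>.\<close>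

lemma is_pseudo_inverse_unique:
  assumes A: "A \<in> carrier_mat r c" and "is_pseudo_inverse A B" "is_pseudo_inverse A C"
  shows "B = C"
proof -
  have B: "B \<in> carrier_mat c r" "A * B * A = A" "B * A * B = B"
      "transpose_mat (A * B) = A * B" "transpose_mat (B * A) = B * A"
    and C: "C \<in> carrier_mat c r" "A * C * A = A" "C * A * C = C"
      "transpose_mat (A * C) = A * C" "transpose_mat (C * A) = C * A"
    using assms by (auto simp: is_pseudo_inverse_def)
  have "(A * C) * (A * B) = (A * C * A) * B"
    by (rule assoc_mult_mat[symmetric]) (use A B(1) C(1) in auto)
  hence "A * B = (A * C) * (A * B)"
    by (simp only: C(2))
  also have "\<dots> = transpose_mat ((A * B) * (A * C))"
    using A B(1) C(1) by (subst transpose_mult[of _ r r _ r]) (auto simp only: B(4) C(4) intro: mult_carrier_mat)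
  also have "(A * B) * (A * C) = (A * B * A) * C"
    by (rule assoc_mult_mat[symmetric]) (use A B(1) C(1) in auto)
  finally have AB: "A * B = A * C" by (simp only: B(2) C(4))
  have "(B * A) * (C * A) = B * (A * (C * A))"
    by (rule assoc_mult_mat) (use A B(1) C(1) in auto)
  also have "A * (C * A) = A * C * A"
    by (rule assoc_mult_mat[symmetric]) (use A C(1) in auto)
  finally have "B * A = (B * A) * (C * A)"
    by (simp only: C(2))
  also have "\<dots> = transpose_mat ((C * A) * (B * A))"
    using A B(1) C(1) by (subst transpose_mult[of _ c c _ c]) (auto simp only: B(5) C(5) intro: mult_carrier_mat)
  also have "(C * A) * (B * A) = C * (A * (B * A))"
    by (rule assoc_mult_mat) (use A B(1) C(1) in auto)
  also have "A * (B * A) = A * B * A"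
    by (rule assoc_mult_mat[symmetric]) (use A B(1) in auto)
  finally have BA: "B * A = C * A" by (simp only: B(2) C(5))
  have "B * A * B = B * (A * C)"
    using AB assoc_mult_mat[OF B(1) A B(1)] by simp
  also have "\<dots> = B * A * C"
    by (rule assoc_mult_mat[OF B(1) A C(1), symmetric])
  also have "\<dots> = C"
    by (simp only: BA C(3))
  finally show ?thesis
    by (simp only: B(3))
qed

lemma pseudo_inverse_sym:
  assumes "W \<in> carrier_mat m m" "transpose_mat W = W"
  shows "is_pseudo_inverse W (pseudo_inverse W)"
    "transpose_mat (pseudo_inverse W) = pseudo_inverse W"
proof -
  obtain B where B: "is_pseudo_inverse W B" "transpose_mat B = B"
    using sym_pseudo_inverse_exists[OF assms] by blast
  have "pseudo_inverse W = B"
    unfolding pseudo_inverse_def using B(1) is_pseudo_inverse_unique[OF assms(1)] by blast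
  thus "is_pseudo_inverse W (pseudo_inverse W)"
    "transpose_mat (pseudo_inverse W) = pseudo_inverse W"
    using B by simp_all
qed

subsection \<open>The deterministic error bound\<close>

text \<open>\<open>B\<close> stands for the pseudo-inverse of the Gram matrix of the
  \<open>\<psi> a\<close>. The operator \<open>P\<close> built from it is self-adjoint and
  idempotent, hence the orthogonal projection onto their span, and
  \<open>r v = v - P v\<close>.\<close>

lemma gram_residual:
  fixes \<psi> :: "nat \<Rightarrow> 'h :: real_inner" and B :: "nat \<Rightarrow> nat \<Rightarrow> real"
  assumes sym: "\<And>a b. a < m \<Longrightarrow> b < m \<Longrightarrow> B a b = B b a"
    and inv: "\<And>c d. c < m \<Longrightarrow> d < m \<Longrightarrow>
      (\<Sum>a<m. \<Sum>b<m. inner (\<psi> c) (\<psi> a) * B a b * inner (\<psi> b) (\<psi> d)) = inner (\<psi> c) (\<psi> d)"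
  shows "\<exists>r :: 'h \<Rightarrow> 'h.
      (\<forall>u v. inner u v - (\<Sum>a<m. \<Sum>b<m. inner u (\<psi> a) * B a b * inner (\<psi> b) v) = inner (r u) (r v)) \<and>
      (\<forall>c<m. \<forall>v. norm (r v) \<le> norm (v - \<psi> c))"
proof -
  define P where "P v = (\<Sum>a<m. (\<Sum>b<m. B a b * inner (\<psi> b) v) *\<^sub>R \<psi> a)" for v
  have inner_P: "inner u (P v) = (\<Sum>a<m. \<Sum>b<m. inner u (\<psi> a) * B a b * inner (\<psi> b) v)" for u v
    by (simp add: P_def inner_sum_right sum_distrib_left sum_distrib_right mult_ac)
  have inner_P_commute: "inner (P u) v = inner u (P v)" for u v
  proof -
    have "inner (P u) v = (\<Sum>a<m. \<Sum>b<m. inner v (\<psi> a) * B a b * inner (\<psi> b) u)"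
      by (simp add: inner_commute[of "P u"] inner_P)
    also have "\<dots> = (\<Sum>b<m. \<Sum>a<m. inner v (\<psi> a) * B a b * inner (\<psi> b) u)"
      by (rule sum.swap)
    also have "\<dots> = inner u (P v)"
      unfolding inner_P by (intro sum.cong refl) (auto simp: sym inner_commute)
    finally show ?thesis .
  qed
  \<comment> \<open>\<open>?d\<close> lies in the span of the \<open>\<psi> a\<close> and, by
    \<open>inv\<close>, is orthogonal to it.\<close>
  have P_psi: "P (\<psi> c) = \<psi> c" if "c < m" for c
  proof -
    let ?d = "P (\<psi> c) - \<psi> c"
    have orth: "inner (\<psi> e) ?d = 0" if "e < m" for e
      using inv[OF that \<open>c < m\<close>] by (simp add: inner_diff_right inner_P)
    have "inner (P v) y = (\<Sum>a<m. (\<Sum>b<m. B a b * inner (\<psi> b) v) * inner (\<psi> a) y)" for v y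
      by (simp add: P_def inner_sum_left)
    from this[of "\<psi> c" ?d] have "inner (P (\<psi> c)) ?d = 0"
      by (simp add: orth)
    hence "inner ?d ?d = 0"
      using orth[OF that] by (simp add: inner_diff_left)
    thus ?thesis by simp
  qed
  have P_scale: "P (s *\<^sub>R v) = s *\<^sub>R P v" for s v
    by (simp add: P_def sum_distrib_left scaleR_sum_right mult_ac)
  have P_add: "P (u + v) = P u + P v" for u v
    by (simp add: P_def inner_add_right distrib_left sum.distrib scaleR_add_left)
  have P_diff: "P (u - v) = P u - P v" for u v
    using P_add[of "u - v" v] by simp
  have P_0: "P 0 = 0"
    by (simp add: P_def)
  have P_sum: "P (sum g A) = (\<Sum>x\<in>A. P (g x))" if "finite A" for g and A :: "nat set"
    using that by (induction A rule: finite_induct) (auto simp: P_add P_0)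
  have P_P: "P (P v) = P v" for v
  proof -
    have "P (P v) = (\<Sum>a<m. (\<Sum>b<m. B a b * inner (\<psi> b) v) *\<^sub>R P (\<psi> a))"
      by (subst (2) P_def) (simp add: P_sum P_scale)
    also have "\<dots> = P v"
      unfolding P_def[of v] by (intro sum.cong refl) (simp add: P_psi)
    finally show ?thesis .
  qed
  have res: "inner (u - P u) (v - P v) = inner u v - inner u (P v)" for u v
    by (simp add: inner_diff_left inner_diff_right inner_P_commute P_P)
  \<comment> \<open>\<open>P\<close> fixes \<open>\<psi> c\<close>, so \<open>v\<close> and
    \<open>v - \<psi> c\<close> have the same residual, and a residual is never longer than its
    vector.\<close>
  have "norm (v - P v) \<le> norm (v - \<psi> c)" if "c < m" for c v
  proof -
    let ?w = "v - \<psi> c"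
    have "v - P v = ?w - P ?w"
      by (simp add: P_diff P_psi[OF that])
    moreover have "inner (?w - P ?w) (?w - P ?w) \<le> inner ?w ?w"
    proof -
      have "inner ?w (P ?w) = inner (P ?w) (P ?w)"
        by (simp only: inner_P_commute P_P)
      thus ?thesis
        unfolding res by simp
    qed
    ultimately show ?thesis
      by (simp only: norm_le)
  qed
  thus ?thesis
    by (intro exI[of _ "\<lambda>v. v - P v"]) (auto simp: res inner_P)
qed

text \<open>Cauchy-Schwarz on each entry: the Frobenius norm of a Gram matrix is at most its
  trace.\<close>

lemma sqrt_sum_inner_sq_le:
  fixes r :: "nat \<Rightarrow> 'h :: real_inner"
  shows "sqrt (\<Sum>i<n. \<Sum>j<n. (inner (r i) (r j))\<^sup>2) \<le> (\<Sum>i<n. (norm (r i))\<^sup>2)"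
proof (rule real_le_lsqrt)
  have "(inner (r i) (r j))\<^sup>2 \<le> (norm (r i))\<^sup>2 * (norm (r j))\<^sup>2" for i j
    using power_mono[OF Cauchy_Schwarz_ineq2[of "r i" "r j"], of 2]
    by (simp add: power_mult_distrib)
  hence "(\<Sum>i<n. \<Sum>j<n. (inner (r i) (r j))\<^sup>2) \<le> (\<Sum>i<n. \<Sum>j<n. (norm (r i))\<^sup>2 * (norm (r j))\<^sup>2)"
    by (intro sum_mono)
  also have "\<dots> = (\<Sum>i<n. (norm (r i))\<^sup>2)\<^sup>2"
    by (simp add: power2_eq_square sum_product)
  finally show "(\<Sum>i<n. \<Sum>j<n. (inner (r i) (r j))\<^sup>2) \<le> (\<Sum>i<n. (norm (r i))\<^sup>2)\<^sup>2" .
qed (auto intro: sum_nonneg)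

lemma triple_mat_mult_index:
  fixes A :: "real mat"
  assumes A: "A \<in> carrier_mat n m" and B: "B \<in> carrier_mat m m" and C: "C \<in> carrier_mat m k"
    and ij: "i < n" "j < k"
  shows "(A * B * C) $$ (i, j) = (\<Sum>a<m. \<Sum>b<m. A $$ (i, a) * B $$ (a, b) * C $$ (b, j))"
  using assms by (auto simp: scalar_prod_def atLeast0LessThan sum_distrib_left mult.assoc)

text \<open>Expanding the squared norm leaves two kernel differences, each changing one argument
  from \<open>x\<close> to \<open>z\<close>; the condition on \<open>\<kappa>\<close> bounds each by
  a square root.\<close>

lemma feature_dist_le:
  fixes \<Phi> :: "real vec \<Rightarrow> 'h :: real_inner"
  assumes \<Phi>: "is_feature_map p \<Phi> \<kappa>"
    and lip: "\<forall>a\<in>carrier_vec p. \<forall>b\<in>carrier_vec p. \<forall>c\<in>carrier_vec p. \<forall>d\<in>carrier_vec p.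
         (\<kappa> a b - \<kappa> c d)\<^sup>2 \<le> \<eta> * (sq_norm_vec (a - c) + sq_norm_vec (b - d))"
    and x: "x \<in> carrier_vec p" and z: "z \<in> carrier_vec p"
  shows "(norm (\<Phi> x - \<Phi> z))\<^sup>2 \<le> 2 * sqrt (\<eta> * sq_norm_vec (x - z))"
proof -
  have 0: "sq_norm_vec (0\<^sub>v p) = 0"
    by (simp add: sq_norm_vec_def)
  have 1: "\<bar>\<kappa> x x - \<kappa> x z\<bar> \<le> sqrt (\<eta> * sq_norm_vec (x - z))"
    using lip[rule_format, OF x x x z] x by (intro real_le_rsqrt) (simp add: 0)
  have 2: "\<bar>\<kappa> x z - \<kappa> z z\<bar> \<le> sqrt (\<eta> * sq_norm_vec (x - z))"
    using lip[rule_format, OF x z z z] z by (intro real_le_rsqrt) (simp add: 0)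
  have "(norm (\<Phi> x - \<Phi> z))\<^sup>2 = (\<kappa> x x - \<kappa> x z) - (\<kappa> x z - \<kappa> z z)"
    using \<Phi> x z unfolding is_feature_map_def
    by (simp add: power2_norm_eq_inner inner_diff_left inner_diff_right inner_commute)
  thus ?thesis
    using 1 2 by linarith
qed

text \<open>Any assignment \<open>c\<close> of points to landmarks is allowed, since projecting onto
  the span is at least as good as picking the single vector \<open>\<psi> (c i)\<close>. The K-means
  assignment is inserted later.\<close>

lemma nystroem_error_le:
  fixes \<Phi> :: "real vec \<Rightarrow> 'h :: real_inner"
  assumes \<Phi>: "is_feature_map p \<Phi> \<kappa>"
    and lip: "\<forall>a\<in>carrier_vec p. \<forall>b\<in>carrier_vec p. \<forall>c\<in>carrier_vec p. \<forall>d\<in>carrier_vec p.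
         (\<kappa> a b - \<kappa> c d)\<^sup>2 \<le> \<eta> * (sq_norm_vec (a - c) + sq_norm_vec (b - d))"
    and X: "X \<in> carrier_mat p n" and Z: "Z \<in> carrier_mat p m"
    and c: "\<And>i. i < n \<Longrightarrow> c i < m"
  shows "nystroem_error \<kappa> X Z \<le> (\<Sum>i<n. 2 * sqrt (\<eta> * sq_norm_vec (col X i - col Z (c i))))"
proof -
  define K where "K = kernel_matrix \<kappa> X X"
  define C where "C = kernel_matrix \<kappa> X Z"
  define W where "W = kernel_matrix \<kappa> Z Z"
  define B where "B = pseudo_inverse W"
  define \<phi> where "\<phi> i = \<Phi> (col X i)" for i
  define \<psi> where "\<psi> i = \<Phi> (col Z i)" for i
  have car: "K \<in> carrier_mat n n" "C \<in> carrier_mat n m" "W \<in> carrier_mat m m"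
    using X Z by (auto simp: K_def C_def W_def kernel_matrix_def)
  have colX: "col X i \<in> carrier_vec p" if "i < n" for i
    using X that by auto
  have colZ: "col Z i \<in> carrier_vec p" if "i < m" for i
    using Z that by auto
  have K: "K $$ (i, j) = inner (\<phi> i) (\<phi> j)" if "i < n" "j < n" for i j
    using that X \<Phi> colX by (simp add: K_def kernel_matrix_def \<phi>_def is_feature_map_def)
  have C: "C $$ (i, j) = inner (\<phi> i) (\<psi> j)" if "i < n" "j < m" for i j
    using that X Z \<Phi> colX colZ
    by (simp add: C_def kernel_matrix_def \<phi>_def \<psi>_def is_feature_map_def)
  have W: "W $$ (i, j) = inner (\<psi> i) (\<psi> j)" if "i < m" "j < m" for i j
    using that Z \<Phi> colZ by (simp add: W_def kernel_matrix_def \<psi>_def is_feature_map_def)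
  have symW: "transpose_mat W = W"
    using car(3) by (intro eq_matI) (auto simp: W inner_commute)
  note inv = pseudo_inverse_sym[OF car(3) symW, folded B_def]
  have B: "B \<in> carrier_mat m m" and WBW: "W * B * W = W"
    using inv(1) car(3) by (auto simp: is_pseudo_inverse_def)
  have "\<exists>r :: 'h \<Rightarrow> 'h.
      (\<forall>u v. inner u v - (\<Sum>a<m. \<Sum>b<m. inner u (\<psi> a) * B $$ (a, b) * inner (\<psi> b) v) = inner (r u) (r v)) \<and>
      (\<forall>c<m. \<forall>v. norm (r v) \<le> norm (v - \<psi> c))"
  proof (rule gram_residual)
    show "B $$ (a, b) = B $$ (b, a)" if "a < m" "b < m" for a b
      using that B arg_cong[OF inv(2), of "\<lambda>M. M $$ (a, b)"] by simp
    show "(\<Sum>a<m. \<Sum>b<m. inner (\<psi> c) (\<psi> a) * B $$ (a, b) * inner (\<psi> b) (\<psi> d)) = inner (\<psi> c) (\<psi> d)"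
      if "c < m" "d < m" for c d
      using triple_mat_mult_index[OF car(3) B car(3) that] that by (simp add: WBW W)
  qed
  then obtain r :: "'h \<Rightarrow> 'h" where
    r: "\<And>u v. inner u v - (\<Sum>a<m. \<Sum>b<m. inner u (\<psi> a) * B $$ (a, b) * inner (\<psi> b) v) = inner (r u) (r v)"
    and r_le: "\<And>c v. c < m \<Longrightarrow> norm (r v) \<le> norm (v - \<psi> c)"
    by blast
  define D where "D = K - C * B * transpose_mat C"
  have D: "D \<in> carrier_mat n n"
    unfolding D_def using car B
    by (intro minus_carrier_mat mult_carrier_mat[of _ n m]) auto
  have "D $$ (i, j) = inner (r (\<phi> i)) (r (\<phi> j))" if ij: "i < n" "j < n" for i j
  proof -
    have "(C * B * transpose_mat C) $$ (i, j)
        = (\<Sum>a<m. \<Sum>b<m. inner (\<phi> i) (\<psi> a) * B $$ (a, b) * inner (\<psi> b) (\<phi> j))"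
      using car B ij by (subst triple_mat_mult_index[of _ n m _ _ n]) (auto simp: C inner_commute)
    thus ?thesis
      using car B ij r[of "\<phi> i" "\<phi> j"] by (simp add: D_def K)
  qed
  hence "frobenius_norm D = sqrt (\<Sum>i<n. \<Sum>j<n. (inner (r (\<phi> i)) (r (\<phi> j)))\<^sup>2)"
    using D by (simp add: frobenius_norm_def)
  also have "\<dots> \<le> (\<Sum>i<n. (norm (r (\<phi> i)))\<^sup>2)"
    by (rule sqrt_sum_inner_sq_le)
  also have "\<dots> \<le> (\<Sum>i<n. 2 * sqrt (\<eta> * sq_norm_vec (col X i - col Z (c i))))"
  proof (rule sum_mono)
    fix i assume "i \<in> {..<n}"
    hence i: "i < n" by simp
    have "(norm (r (\<phi> i)))\<^sup>2 \<le> (norm (\<phi> i - \<psi> (c i)))\<^sup>2"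
      using r_le[OF c[OF i]] by (simp add: power_mono)
    also have "\<dots> \<le> 2 * sqrt (\<eta> * sq_norm_vec (col X i - col Z (c i)))"
      unfolding \<phi>_def \<psi>_def using i by (intro feature_dist_le[OF \<Phi> lip] colX colZ c)
    finally show "(norm (r (\<phi> i)))\<^sup>2 \<le> 2 * sqrt (\<eta> * sq_norm_vec (col X i - col Z (c i)))" .
  qed
  finally show ?thesis
    by (simp add: nystroem_error_def Let_def D_def K_def C_def W_def B_def)
qed

subsection \<open>Random pivots\<close>

definition dotp :: "nat \<Rightarrow> (nat \<Rightarrow> real) \<Rightarrow> (nat \<Rightarrow> real) \<Rightarrow> real" where
  "dotp p u v = (\<Sum>i<p. u i * v i)"

definition nrm2 :: "nat \<Rightarrow> (nat \<Rightarrow> real) \<Rightarrow> real" where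
  "nrm2 p u = (\<Sum>i<p. (u i)\<^sup>2)"

text \<open>Membership in the linear span, on the first \<open>p\<close> coordinates only. Splitting
  off the head coefficient matches an elimination that removes the head of the list.\<close>

fun in_span :: "nat \<Rightarrow> (nat \<Rightarrow> real) list \<Rightarrow> (nat \<Rightarrow> real) \<Rightarrow> bool" where
  "in_span p [] x \<longleftrightarrow> (\<forall>i<p. x i = 0)"
| "in_span p (u # L) x \<longleftrightarrow> (\<exists>a. in_span p L (\<lambda>i. x i - a * u i))"

lemma dotp_diff_scale: "dotp p w (\<lambda>i. x i - a * y i) = dotp p w x - a * dotp p w y"
  by (simp add: dotp_def right_diff_distrib sum_subtractf sum_distrib_left mult_ac)

lemma dotp_diff: "dotp p w (\<lambda>i. x i - y i) = dotp p w x - dotp p w y"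
  using dotp_diff_scale[of p w x 1 y] by simp

lemma dotp_sq_le: "(dotp p w x)\<^sup>2 \<le> nrm2 p w * nrm2 p x"
  unfolding dotp_def nrm2_def by (rule Cauchy_Schwarz_ineq_sum)

lemma nrm2_nonneg [simp]: "nrm2 p x \<ge> 0"
  by (simp add: nrm2_def sum_nonneg)

lemma nrm2_scale: "nrm2 p (\<lambda>i. a * x i) = a\<^sup>2 * nrm2 p x"
  by (simp add: nrm2_def power_mult_distrib sum_distrib_left)

lemma nrm2_add_le: "nrm2 p (\<lambda>i. x i + y i) \<le> 2 * nrm2 p x + 2 * nrm2 p y"
proof -
  have "(s + t)\<^sup>2 \<le> 2 * s\<^sup>2 + 2 * t\<^sup>2" for s t :: real
    using sum_squares_bound[of s t] by (simp add: power2_sum)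
  thus ?thesis
    unfolding nrm2_def sum_distrib_left sum.distrib[symmetric] by (intro sum_mono)
qed

lemma in_span_zero: "in_span p L (\<lambda>_. 0)"
proof (induction L)
  case (Cons u L)
  thus ?case by (auto intro: exI[of _ 0])
qed simp

lemma in_span_add:
  "in_span p L x \<Longrightarrow> in_span p L y \<Longrightarrow> in_span p L (\<lambda>i. x i + c * y i)"
proof (induction L arbitrary: x y)
  case (Cons u L)
  then obtain a b where "in_span p L (\<lambda>i. x i - a * u i)" "in_span p L (\<lambda>i. y i - b * u i)"
    by auto
  from Cons.IH[OF this] have "in_span p L (\<lambda>i. (x i + c * y i) - (a + c * b) * u i)"
    by (simp add: algebra_simps)
  thus ?case by auto
qed simp

lemma in_span_mem: "u \<in> set L \<Longrightarrow> in_span p L u"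
proof (induction L)
  case (Cons v L)
  show ?case
  proof (cases "u = v")
    case True
    thus ?thesis
      using in_span_zero by (auto intro!: exI[of _ 1])
  next
    case False
    thus ?thesis
      using Cons by (auto intro!: exI[of _ 0])
  qed
qed simp

lemma in_span_sum:
  assumes "finite A" "\<And>j. j \<in> A \<Longrightarrow> in_span p L (y j)"
  shows "in_span p L (\<lambda>i. \<Sum>j\<in>A. c j * y j i)"
  using assms
proof (induction A rule: finite_induct)
  case empty
  show ?case using in_span_zero by simp
next
  case (insert j A)
  have "in_span p L (\<lambda>i. (\<Sum>j\<in>A. c j * y j i) + c j * y j i)"
    using insert by (intro in_span_add) auto
  thus ?case using insert by (simp add: add.commute)
qed

text \<open>Subtracts from \<open>l\<close> the multiple of \<open>u\<close> that makes the linear functional \<open>d\<close> vanish;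
  if \<open>d u = 0\<close>, then \<open>l\<close> is unchanged.\<close>

definition eliminate :: "((nat \<Rightarrow> real) \<Rightarrow> real) \<Rightarrow> (nat \<Rightarrow> real) \<Rightarrow> (nat \<Rightarrow> real) \<Rightarrow> nat \<Rightarrow> real" where
  "eliminate d u l = (\<lambda>i. l i - d l / d u * u i)"

lemma eliminate_diff_scale:
  "eliminate (dotp p w) u (\<lambda>i. x i - a * v i)
    = (\<lambda>i. eliminate (dotp p w) u x i - a * eliminate (dotp p w) u v i)"
  by (simp add: eliminate_def fun_eq_iff dotp_diff_scale diff_divide_distrib algebra_simps)

lemma in_span_eliminate:
  "in_span p L x \<Longrightarrow> in_span p (map (eliminate (dotp p w) u) L) (eliminate (dotp p w) u x)"
proof (induction L arbitrary: x)
  case Nil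
  hence "dotp p w x = 0"
    by (simp add: dotp_def)
  thus ?case using Nil by (simp add: eliminate_def)
next
  case (Cons v L)
  then obtain a where "in_span p L (\<lambda>i. x i - a * v i)"
    by auto
  from Cons.IH[OF this]
  have "in_span p (map (eliminate (dotp p w) u) L)
      (\<lambda>i. eliminate (dotp p w) u x i - a * eliminate (dotp p w) u v i)"
    by (simp only: eliminate_diff_scale)
  thus ?case by auto
qed

text \<open>The threshold is what one entry of size \<open>a\<close> achieves on a largest
  coordinate of \<open>u\<close>, whose square is at least \<open>nrm2 p u / p\<close>. A vector
  vanishing on the first \<open>p\<close> coordinates always passes.\<close>

definition good_pivot :: "nat \<Rightarrow> real \<Rightarrow> ((nat \<Rightarrow> real) \<Rightarrow> real) \<Rightarrow> (nat \<Rightarrow> real) \<Rightarrow> bool" where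
  "good_pivot p a d u \<longleftrightarrow> a\<^sup>2 * nrm2 p u \<le> real p * (d u)\<^sup>2"

text \<open>A state consists of the current spanning list and the number of good pivots so far; when the
  list is used up, the elimination restarts with \<open>B\<close>.\<close>

definition pivot_step where
  "pivot_step p a B d s = (case s of
     ([], T) \<Rightarrow> ([], T)
   | (u # L, T) \<Rightarrow> if good_pivot p a d u
       then (if L = [] then B else map (eliminate d u) L, Suc T) else (u # L, T))"

fun pivot_state ::
  "nat \<Rightarrow> real \<Rightarrow> (nat \<Rightarrow> real) list \<Rightarrow> (nat \<times> nat \<Rightarrow> real) \<Rightarrow> nat \<Rightarrow> (nat \<Rightarrow> real) list \<times> nat" where
  "pivot_state p a B f 0 = (B, 0)"
| "pivot_state p a B f (Suc k) = pivot_step p a B (dotp p (\<lambda>i. f (k, i))) (pivot_state p a B f k)"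

text \<open>The factor by which one elimination step worsens the bound in \<open>eliminate_dist\<close> below.\<close>

definition pivot_const :: "nat \<Rightarrow> real" where
  "pivot_const p = 2 + 4 * real p + 4 * (real p)\<^sup>2"

lemma pivot_const_ge: "pivot_const p \<ge> 1"
  by (simp add: pivot_const_def)

text \<open>Either the row \<open>w\<close> detects \<open>x\<close>, or \<open>x\<close> stays
  close to a smaller span: \<open>l\<close> is moved along \<open>u\<close> until its product with
  \<open>w\<close> vanishes. The shift depends on \<open>dotp p w l\<close>, which is small when
  \<open>dotp p w x\<close> and \<open>x - l\<close> are, and a good pivot bounds the
  displacement.\<close>

lemma eliminate_dist:
  assumes "a > 0" and w: "nrm2 p w \<le> real p * a\<^sup>2" and good: "good_pivot p a (dotp p w) u"
    and l: "in_span p (u # L) l" "a\<^sup>2 * nrm2 p (\<lambda>i. x i - l i) \<le> C" "C \<ge> 0"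
  shows "\<exists>l'. in_span p (map (eliminate (dotp p w) u) L) l' \<and>
    a\<^sup>2 * nrm2 p (\<lambda>i. x i - l' i) \<le> pivot_const p * (C + (dotp p w x)\<^sup>2)"
proof -
  let ?d = "dotp p w" and ?P = "real p"
  obtain b where b: "in_span p L (\<lambda>i. l i - b * u i)"
    using l by auto
  have good': "a\<^sup>2 * nrm2 p u \<le> ?P * (?d u)\<^sup>2"
    using good by (simp add: good_pivot_def)
  \<comment> \<open>A good pivot with \<open>?d u = 0\<close> forces \<open>u\<close> to vanish, so
    the division by zero does no harm.\<close>
  have u0: "\<forall>i<p. u i = 0" if "?d u = 0"
  proof -
    have "a\<^sup>2 * nrm2 p u \<le> 0"
      using good' that by simp
    hence "nrm2 p u \<le> 0"
      using \<open>a > 0\<close> by (simp add: mult_le_0_iff)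
    hence "nrm2 p u = 0"
      by (simp add: antisym)
    thus ?thesis
      unfolding nrm2_def by (subst (asm) sum_nonneg_eq_0_iff) auto
  qed
  let ?l = "eliminate ?d u (\<lambda>i. l i - b * u i)"
  \<comment> \<open>The coefficient \<open>b\<close> drops out, since eliminating along
    \<open>u\<close> ignores multiples of \<open>u\<close>.\<close>
  have eq: "x i - ?l i = (x i - l i) + ?d l / ?d u * u i" if "i < p" for i
    using u0 that by (cases "?d u = 0") (auto simp: eliminate_def dotp_diff_scale field_simps)
  have "nrm2 p (\<lambda>i. x i - ?l i) = nrm2 p (\<lambda>i. (x i - l i) + ?d l / ?d u * u i)"
    unfolding nrm2_def by (intro sum.cong refl) (simp add: eq)
  also have "\<dots> \<le> 2 * nrm2 p (\<lambda>i. x i - l i) + 2 * nrm2 p (\<lambda>i. ?d l / ?d u * u i)"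
    by (rule nrm2_add_le)
  finally have "a\<^sup>2 * nrm2 p (\<lambda>i. x i - ?l i)
      \<le> a\<^sup>2 * (2 * nrm2 p (\<lambda>i. x i - l i) + 2 * nrm2 p (\<lambda>i. ?d l / ?d u * u i))"
    by (rule mult_left_mono) simp
  also have "\<dots> = 2 * (a\<^sup>2 * nrm2 p (\<lambda>i. x i - l i)) + 2 * ((?d l / ?d u)\<^sup>2 * (a\<^sup>2 * nrm2 p u))"
    by (simp only: nrm2_scale) (simp add: algebra_simps)
  also have "\<dots> \<le> 2 * C + 2 * (?P * (2 * (?d x)\<^sup>2 + 2 * (?P * C)))"
  proof -
    have "(?d l / ?d u)\<^sup>2 * (a\<^sup>2 * nrm2 p u) \<le> (?d l / ?d u)\<^sup>2 * (?P * (?d u)\<^sup>2)"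
      by (intro mult_left_mono good') auto
    also have "\<dots> \<le> ?P * (?d l)\<^sup>2"
      by (simp add: power_divide)
    also have "(?d l)\<^sup>2 \<le> 2 * (?d x)\<^sup>2 + 2 * (?P * C)"
    proof -
      have *: "(?d (\<lambda>i. x i - l i))\<^sup>2 \<le> ?P * C"
      proof -
        have "(?d (\<lambda>i. x i - l i))\<^sup>2 \<le> nrm2 p w * nrm2 p (\<lambda>i. x i - l i)"
          by (rule dotp_sq_le)
        also have "\<dots> \<le> (?P * a\<^sup>2) * nrm2 p (\<lambda>i. x i - l i)"
          by (rule mult_right_mono[OF w]) simp
        also have "\<dots> \<le> ?P * C"
          using l(2) by (simp add: mult.assoc mult_left_mono)
        finally show ?thesis .
      qed
      have "(s - t)\<^sup>2 \<le> 2 * s\<^sup>2 + 2 * t\<^sup>2" for s t :: real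
        using sum_squares_bound[of s "- t"] by (simp add: power2_diff)
      from this[of "?d x" "?d (\<lambda>i. x i - l i)"]
      have "(?d l)\<^sup>2 \<le> 2 * (?d x)\<^sup>2 + 2 * (?d (\<lambda>i. x i - l i))\<^sup>2"
        by (simp add: dotp_diff)
      thus ?thesis using * by linarith
    qed
    finally show ?thesis
      using l(2) by (auto simp: mult_left_mono)
  qed
  also have "\<dots> \<le> pivot_const p * (C + (?d x)\<^sup>2)"
  proof -
    have "0 \<le> ?P * C" "0 \<le> ?P\<^sup>2 * (?d x)\<^sup>2" "0 \<le> (?d x)\<^sup>2"
      using l(3) by auto
    thus ?thesis
      by (simp add: pivot_const_def algebra_simps power2_eq_square)
  qed
  finally have "a\<^sup>2 * nrm2 p (\<lambda>i. x i - ?l i) \<le> pivot_const p * (C + (?d x)\<^sup>2)" .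
  thus ?thesis
    using in_span_eliminate[OF b] by blast
qed

text \<open>\<open>c\<close> counts the completed rounds of \<open>m\<close> good pivots, each of
  which has earned \<open>a^2 * nrm2 p x / pivot_const p ^ m\<close> of the sum of squares;
  \<open>q\<close> is what was gathered since the last restart. Within a round, each good pivot
  keeps \<open>x\<close> near the span of the shortened list at the cost of one factor
  \<open>pivot_const p\<close>.\<close>

lemma pivot_state_invariant:
  assumes "a > 0" and B: "B \<noteq> []" "length B = m" and x: "in_span p B x"
    and w: "\<And>j. j < k \<Longrightarrow> nrm2 p (\<lambda>i. f (j, i)) \<le> real p * a\<^sup>2"
    and st: "pivot_state p a B f k = (L, T)"
  shows "L \<noteq> [] \<and> length L \<le> m \<and> (\<exists>c q l. q \<ge> 0 \<and> T = c * m + (m - length L) \<and>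
    a\<^sup>2 * nrm2 p x / pivot_const p ^ m * real c + q \<le> (\<Sum>j<k. (dotp p (\<lambda>i. f (j, i)) x)\<^sup>2) \<and>
    in_span p L l \<and> a\<^sup>2 * nrm2 p (\<lambda>i. x i - l i) \<le> pivot_const p ^ (m - length L) * q)"
  using w st
proof (induction k arbitrary: L T)
  case 0
  have "nrm2 p (\<lambda>i. x i - x i) = 0"
    by (simp add: nrm2_def)
  thus ?case
    using 0 B x by (auto intro!: exI[of _ "0::nat"] exI[of _ "0::real"] exI[of _ x])
next
  case (Suc k)
  let ?K = "pivot_const p"
  let ?d = "dotp p (\<lambda>i. f (k, i))"
  let ?S = "\<lambda>k. \<Sum>j<k. (dotp p (\<lambda>i. f (j, i)) x)\<^sup>2"
  have K: "?K \<ge> 1" by (rule pivot_const_ge)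
  obtain L0 T0 where st0: "pivot_state p a B f k = (L0, T0)"
    by fastforce
  from Suc.IH[OF Suc.prems(1) st0] obtain c q l where
    L0: "L0 \<noteq> []" "length L0 \<le> m" and q: "q \<ge> 0" and T0: "T0 = c * m + (m - length L0)"
    and S: "a\<^sup>2 * nrm2 p x / ?K ^ m * real c + q \<le> ?S k"
    and l: "in_span p L0 l" "a\<^sup>2 * nrm2 p (\<lambda>i. x i - l i) \<le> ?K ^ (m - length L0) * q"
    by auto
  obtain u L' where L0_eq: "L0 = u # L'"
    using L0 by (cases L0) auto
  have S': "a\<^sup>2 * nrm2 p x / ?K ^ m * real c + (q + (?d x)\<^sup>2) \<le> ?S (Suc k)"
    using S by simp
  have step: "(L, T) = pivot_step p a B ?d (u # L', T0)"
    using Suc.prems(2) st0 L0_eq by simp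
  show ?case
  proof (cases "good_pivot p a ?d u")
    \<comment> \<open>A bad pivot leaves the list alone; the square from its row only enlarges
      \<open>q\<close>.\<close>
    case False
    hence LT: "L = L0" "T = T0"
      using step L0_eq by (auto simp: pivot_step_def)
    have "?K ^ (m - length L0) * q \<le> ?K ^ (m - length L0) * (q + (?d x)\<^sup>2)"
      using K by (intro mult_left_mono) auto
    hence l': "a\<^sup>2 * nrm2 p (\<lambda>i. x i - l i) \<le> ?K ^ (m - length L0) * (q + (?d x)\<^sup>2)"
      using l(2) by linarith
    show ?thesis
      unfolding LT using L0 T0 l(1) l' q S'
      by (intro conjI exI[of _ c] exI[of _ "q + (?d x)\<^sup>2"] exI[of _ l]) auto
  next
    case True
    have len: "m - length L' = Suc (m - length L0)"
      using L0(2) L0_eq by (auto simp: Suc_diff_Suc)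
    have "\<exists>l'. in_span p (map (eliminate ?d u) L') l' \<and>
        a\<^sup>2 * nrm2 p (\<lambda>i. x i - l' i) \<le> ?K * (?K ^ (m - length L0) * q + (?d x)\<^sup>2)"
      using l q K L0_eq Suc.prems(1)[of k] by (intro eliminate_dist[OF \<open>a > 0\<close> _ True]) auto
    then obtain l' where l': "in_span p (map (eliminate ?d u) L') l'"
      "a\<^sup>2 * nrm2 p (\<lambda>i. x i - l' i) \<le> ?K * (?K ^ (m - length L0) * q + (?d x)\<^sup>2)"
      by blast
    note l'(2)
    also have "?K * (?K ^ (m - length L0) * q + (?d x)\<^sup>2)
        \<le> ?K * (?K ^ (m - length L0) * q + ?K ^ (m - length L0) * (?d x)\<^sup>2)"
    proof -
      have "1 * (?d x)\<^sup>2 \<le> ?K ^ (m - length L0) * (?d x)\<^sup>2"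
        using K by (intro mult_right_mono) auto
      thus ?thesis
        using K by (intro mult_left_mono add_left_mono) auto
    qed
    also have "\<dots> = ?K ^ (m - length L') * (q + (?d x)\<^sup>2)"
      by (simp add: len algebra_simps)
    finally have l'_le: "a\<^sup>2 * nrm2 p (\<lambda>i. x i - l' i) \<le> ?K ^ (m - length L') * (q + (?d x)\<^sup>2)" .
    show ?thesis
    proof (cases "L' = []")
      \<comment> \<open>The list is exhausted, so \<open>l'\<close> vanishes and \<open>x\<close>
        itself is bounded by what the round gathered. The round has earned its share, and the next
        one starts with \<open>l = x\<close> and \<open>q = 0\<close>.\<close>
      case True
      have LT: "L = B" "T = Suc T0"
        using step \<open>good_pivot p a ?d u\<close> True by (auto simp: pivot_step_def)
      have "nrm2 p (\<lambda>i. x i - l' i) = nrm2 p x"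
        using l'(1) True by (simp add: nrm2_def)
      hence "a\<^sup>2 * nrm2 p x \<le> ?K ^ m * (q + (?d x)\<^sup>2)"
        using l'_le True by simp
      hence "a\<^sup>2 * nrm2 p x / ?K ^ m \<le> q + (?d x)\<^sup>2"
        using K by (simp add: divide_le_eq mult.commute)
      hence "a\<^sup>2 * nrm2 p x / ?K ^ m * real (Suc c) + 0 \<le> ?S (Suc k)"
        using S' distrib_left[of "a\<^sup>2 * nrm2 p x / ?K ^ m" "real c" 1]
        by (simp only: of_nat_Suc add.commute[of 1])
      moreover have "T = Suc c * m + (m - length B)"
        using LT T0 L0_eq True B L0(2) by simp
      moreover have "a\<^sup>2 * nrm2 p (\<lambda>i. x i - x i) \<le> ?K ^ (m - length B) * 0"
        by (simp add: nrm2_def)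
      ultimately show ?thesis
        unfolding LT(1) using B x by blast
    next
      case False
      have LT: "L = map (eliminate ?d u) L'" "T = Suc T0"
        using step \<open>good_pivot p a ?d u\<close> False by (auto simp: pivot_step_def)
      have "T = c * m + (m - length L)"
        using LT T0 len by simp
      moreover have "q + (?d x)\<^sup>2 \<ge> 0"
        using q by simp
      moreover have "L \<noteq> []" "length L \<le> m"
        using LT False L0(2) L0_eq by auto
      moreover have "a\<^sup>2 * nrm2 p (\<lambda>i. x i - l' i) \<le> ?K ^ (m - length L) * (q + (?d x)\<^sup>2)"
        using l'_le LT by simp
      moreover have "in_span p L l'"
        using l'(1) LT by simp
      ultimately show ?thesis
        using S' by blast
    qed
  qed
qed

text \<open>The list is never empty, so fewer than \<open>length B\<close> good pivots belong to the
  unfinished round and the quotient counts the completed ones.\<close>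

lemma span_lower_bound:
  assumes "a > 0" and B: "B \<noteq> []" and x: "in_span p B x"
    and w: "\<And>j. j < k \<Longrightarrow> nrm2 p (\<lambda>i. f (j, i)) \<le> real p * a\<^sup>2"
  shows "a\<^sup>2 * nrm2 p x / pivot_const p ^ length B * real (snd (pivot_state p a B f k) div length B)
    \<le> (\<Sum>j<k. (dotp p (\<lambda>i. f (j, i)) x)\<^sup>2)"
proof -
  let ?m = "length B"
  obtain L T where st: "pivot_state p a B f k = (L, T)"
    by fastforce
  from pivot_state_invariant[OF assms(1) B refl x w st] obtain c q where
    L: "L \<noteq> []" "length L \<le> ?m" and q: "q \<ge> 0" "T = c * ?m + (?m - length L)"
      "a\<^sup>2 * nrm2 p x / pivot_const p ^ ?m * real c + q \<le> (\<Sum>j<k. (dotp p (\<lambda>i. f (j, i)) x)\<^sup>2)"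
    by blast
  have "?m - length L < ?m"
    using L(1) B by simp
  hence "T div ?m = c"
    using q(2) by (intro div_nat_eqI) (simp_all add: mult.commute)
  thus ?thesis
    using q st by simp
qed

section \<open>Probability of many good pivots\<close>

lemma large_coordinate:
  assumes "p > 0"
  shows "\<exists>j<p. nrm2 p u \<le> real p * (u j)\<^sup>2"
proof (rule ccontr)
  assume "\<not> ?thesis"
  hence "real p * (u j)\<^sup>2 < nrm2 p u" if "j < p" for j
    using that by (auto simp: not_le)
  hence "(\<Sum>j<p. real p * (u j)\<^sup>2) < (\<Sum>j<p. nrm2 p u)"
    using assms by (intro sum_strict_mono) auto
  thus False
    by (simp add: nrm2_def sum_distrib_left)
qed

definition sign_pmf :: "real \<Rightarrow> (nat \<times> nat) set \<Rightarrow> (nat \<times> nat \<Rightarrow> real) pmf" where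
  "sign_pmf a A = Pi_pmf A 0 (\<lambda>_. pmf_of_set {a, - a})"

text \<open>Flipping the sign of the entry that meets a largest coordinate of \<open>u\<close> moves the inner
  product by twice that coordinate, so at least one of the two choices is a good pivot.\<close>

lemma good_pivot_probability:
  assumes "a > 0"
  shows "(\<integral>\<^sup>+ g. ennreal (if good_pivot p a (dotp p (\<lambda>i. g (k, i))) u then 1 / 3 else 1)
      \<partial>sign_pmf a ({k} \<times> {..<p})) \<le> ennreal (2 / 3)"
proof (cases "p = 0")
  case True
  thus ?thesis
    by (auto simp: good_pivot_def nrm2_def intro!: ennreal_leI)
next
  case False
  then obtain j where j: "j < p" "nrm2 p u \<le> real p * (u j)\<^sup>2"
    using large_coordinate[of p u] by auto
  let ?A = "{k} \<times> ({..<p} - {j})"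
  let ?F = "\<lambda>g. if good_pivot p a (dotp p (\<lambda>i. g (k, i))) u then 1 / 3 else 1 :: real"
  have ins: "{k} \<times> {..<p} = insert (k, j) ?A"
    using j by auto
  \<comment> \<open>With the other entries of the row fixed, at least one choice contributes
    \<open>1 / 3\<close> and the other at most 1.\<close>
  have bound: "?F (g((k, j) := a)) + ?F (g((k, j) := - a)) \<le> 4 / 3" for g
  proof -
    let ?s = "\<Sum>i\<in>{..<p} - {j}. g (k, i) * u i"
    have dot: "dotp p (\<lambda>i. (g((k, j) := y)) (k, i)) u = y * u j + ?s" for y
      unfolding dotp_def using j by (subst sum.remove[of _ j]) (auto intro!: sum.cong)
    have good: "good_pivot p a (dotp p (\<lambda>i. (g((k, j) := y)) (k, i))) u"
      if "y\<^sup>2 = a\<^sup>2" "y * u j * ?s \<ge> 0" for y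
    proof -
      have "(y * u j)\<^sup>2 \<le> (y * u j + ?s)\<^sup>2"
        using that(2) by (simp add: power2_sum mult.assoc)
      have "a\<^sup>2 * nrm2 p u \<le> a\<^sup>2 * (real p * (u j)\<^sup>2)"
        by (rule mult_left_mono[OF j(2)]) simp
      also have "\<dots> = real p * (y * u j)\<^sup>2"
        using that(1) by (simp add: power_mult_distrib)
      also have "\<dots> \<le> real p * (y * u j + ?s)\<^sup>2"
        by (rule mult_left_mono) (fact, simp)
      finally show ?thesis
        by (simp add: good_pivot_def dot del: fun_upd_apply)
    qed
    have "a * u j * ?s \<ge> 0 \<or> - a * u j * ?s \<ge> 0"
      by simp linarith
    hence "good_pivot p a (dotp p (\<lambda>i. (g((k, j) := a)) (k, i))) u \<or>
        good_pivot p a (dotp p (\<lambda>i. (g((k, j) := - a)) (k, i))) u"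
      using good[of a] good[of "- a"] by (auto simp del: fun_upd_apply)
    thus ?thesis
      by (auto simp del: fun_upd_apply)
  qed
  have ne: "a \<noteq> - a"
    using assms by simp
  have "(\<integral>\<^sup>+ g. ennreal (?F g) \<partial>sign_pmf a ({k} \<times> {..<p}))
      = (\<integral>\<^sup>+ y. \<integral>\<^sup>+ g. ennreal (?F (g((k, j) := y))) \<partial>sign_pmf a ?A \<partial>pmf_of_set {a, - a})"
    unfolding sign_pmf_def ins
    by (subst Pi_pmf_insert) (auto simp: nn_integral_pair_pmf' simp del: fun_upd_apply)
  also have "\<dots> = ((\<integral>\<^sup>+ g. ennreal (?F (g((k, j) := a))) \<partial>sign_pmf a ?A)
      + (\<integral>\<^sup>+ g. ennreal (?F (g((k, j) := - a))) \<partial>sign_pmf a ?A)) / 2"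
    using ne by (subst nn_integral_pmf_of_set) (auto simp del: fun_upd_apply)
  also have "\<dots> = (\<integral>\<^sup>+ g. ennreal (?F (g((k, j) := a)) + ?F (g((k, j) := - a))) \<partial>sign_pmf a ?A) / 2"
    by (subst nn_integral_add[symmetric])
      (auto simp: ennreal_plus[symmetric] simp del: fun_upd_apply ennreal_plus intro!: arg_cong2[where f = "(/)"] nn_integral_cong)
  also have "\<dots> \<le> (\<integral>\<^sup>+ g. ennreal (4 / 3) \<partial>sign_pmf a ?A) / 2"
    by (intro divide_right_mono_ennreal nn_integral_mono ennreal_leI bound)
  also have "\<dots> = ennreal (4 / 3) / ennreal 2"
    by simp
  also have "\<dots> = ennreal (2 / 3)"
    by (subst divide_ennreal) auto
  finally show ?thesis .
qed

text \<open>Makes the next row independent of the vector on which it is tested.\<close>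

lemma pivot_state_cong:
  assumes "\<And>j i. j < k \<Longrightarrow> i < p \<Longrightarrow> f (j, i) = g (j, i)"
  shows "pivot_state p a B f k = pivot_state p a B g k"
  using assms
proof (induction k)
  case (Suc k)
  have "dotp p (\<lambda>i. f (k, i)) = dotp p (\<lambda>i. g (k, i))"
    using Suc.prems by (auto simp: dotp_def fun_eq_iff intro!: sum.cong)
  thus ?case
    using Suc by simp
qed simp

lemma pivot_step_count:
  "L \<noteq> [] \<Longrightarrow> snd (pivot_step p a B d (L, T)) = (if good_pivot p a d (hd L) then Suc T else T)"
  by (cases L) (auto simp: pivot_step_def)

lemma pivot_state_nonempty:
  assumes "B \<noteq> []"
  shows "fst (pivot_state p a B f k) \<noteq> []"
proof (induction k)
  case (Suc k)
  obtain L T where s: "pivot_state p a B f k = (L, T)" by fastforce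
  thus ?case
    using Suc assms by (cases L) (auto simp: pivot_step_def)
qed (use assms in simp)

text \<open>Given the first \<open>k\<close> rows, the tested vector is fixed, so a fresh row
  multiplies the expectation of \<open>(1 / 3) ^ T\<close> by at most
  \<open>1/2 * 1/3 + 1/2 = 2/3\<close>. Conditioning row by row handles the dependence between
  pivots.\<close>

lemma pivot_count_mgf:
  assumes "a > 0" "B \<noteq> []"
  shows "(\<integral>\<^sup>+ f. ennreal ((1 / 3) ^ snd (pivot_state p a B f k)) \<partial>sign_pmf a ({..<k} \<times> {..<p}))
    \<le> ennreal ((2 / 3) ^ k)"
proof (induction k)
  case 0
  show ?case by simp
next
  case (Suc k)
  let ?A = "{..<k} \<times> {..<p}" and ?R = "{k} \<times> {..<p}"
  let ?h = "\<lambda>f g x. if x \<in> ?A then f x else (g x :: real)"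
  let ?T = "\<lambda>f. snd (pivot_state p a B f k)"
  let ?G = "\<lambda>f g. if good_pivot p a (dotp p (\<lambda>i. g (k, i))) (hd (fst (pivot_state p a B f k)))
    then 1 / 3 else 1 :: real"
  have un: "{..<Suc k} \<times> {..<p} = ?A \<union> ?R"
    by auto
  have merge: "(1 / 3) ^ snd (pivot_state p a B (?h f g) (Suc k)) = (1 / 3) ^ ?T f * ?G f g" for f g
  proof -
    have st: "pivot_state p a B (?h f g) k = pivot_state p a B f k"
      by (rule pivot_state_cong) auto
    have row: "dotp p (\<lambda>i. ?h f g (k, i)) = dotp p (\<lambda>i. g (k, i))"
      by (auto simp: dotp_def)
    obtain L T where s: "pivot_state p a B f k = (L, T)" by fastforce
    have "L \<noteq> []"
      using pivot_state_nonempty[OF assms(2), of p a f k] s by simp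
    thus ?thesis
      unfolding pivot_state.simps st row s by (simp add: pivot_step_count)
  qed
  have "(\<integral>\<^sup>+ f. ennreal ((1 / 3) ^ snd (pivot_state p a B f (Suc k))) \<partial>sign_pmf a ({..<Suc k} \<times> {..<p}))
    = (\<integral>\<^sup>+ f. \<integral>\<^sup>+ g. ennreal ((1 / 3) ^ snd (pivot_state p a B (?h f g) (Suc k))) \<partial>sign_pmf a ?R \<partial>sign_pmf a ?A)"
    unfolding sign_pmf_def un
    by (subst Pi_pmf_union) (auto simp: nn_integral_pair_pmf' simp del: pivot_state.simps)
  also have "\<dots> = (\<integral>\<^sup>+ f. ennreal ((1 / 3) ^ ?T f) * (\<integral>\<^sup>+ g. ennreal (?G f g) \<partial>sign_pmf a ?R) \<partial>sign_pmf a ?A)"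
    unfolding merge by (subst nn_integral_cmult[symmetric])
      (auto simp: ennreal_mult simp del: pivot_state.simps intro!: nn_integral_cong)
  also have "\<dots> \<le> (\<integral>\<^sup>+ f. ennreal ((1 / 3) ^ ?T f) * ennreal (2 / 3) \<partial>sign_pmf a ?A)"
    by (intro nn_integral_mono mult_left_mono good_pivot_probability assms) auto
  also have "\<dots> = (\<integral>\<^sup>+ f. ennreal ((1 / 3) ^ ?T f) \<partial>sign_pmf a ?A) * ennreal (2 / 3)"
    by (rule nn_integral_multc) simp
  also have "\<dots> \<le> ennreal ((2 / 3) ^ k) * ennreal (2 / 3)"
    by (intro mult_right_mono Suc.IH) auto
  also have "\<dots> = ennreal ((2 / 3) ^ Suc k)"
    by (simp add: ennreal_mult[symmetric] mult.commute)
  finally show ?case .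
qed

text \<open>Markov's inequality for \<open>(1 / 3) ^ T\<close>: with \<open>d = k div 4\<close>, the
  failure probability is at most
  \<open>3 ^ d * (2 / 3) ^ k \<le> (3 * 16 / 81) ^ d = (16 / 27) ^ d\<close>.\<close>

lemma pivot_count_probability:
  assumes "a > 0" "B \<noteq> []" "k \<ge> 28"
  shows "measure_pmf.prob (sign_pmf a ({..<k} \<times> {..<p}))
    {f. k div 4 < snd (pivot_state p a B f k)} \<ge> 0.96"
proof -
  let ?M = "sign_pmf a ({..<k} \<times> {..<p})" and ?T = "\<lambda>f. snd (pivot_state p a B f k)"
  let ?d = "k div 4"
  let ?bad = "{f. ?T f \<le> ?d}"
  have "ennreal ((1 / 3) ^ ?d) * emeasure ?M ?bad = (\<integral>\<^sup>+ f. ennreal ((1 / 3) ^ ?d) * indicator ?bad f \<partial>?M)"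
    by (rule nn_integral_cmult_indicator[symmetric]) simp
  also have "\<dots> \<le> (\<integral>\<^sup>+ f. ennreal ((1 / 3) ^ ?T f) \<partial>?M)"
    by (intro nn_integral_mono) (auto simp: indicator_def intro!: ennreal_leI power_decreasing)
  also have "\<dots> \<le> ennreal ((2 / 3) ^ k)"
    by (rule pivot_count_mgf) fact+
  finally have "ennreal ((1 / 3) ^ ?d * measure_pmf.prob ?M ?bad) \<le> ennreal ((2 / 3) ^ k)"
    by (simp add: measure_pmf.emeasure_eq_measure ennreal_mult)
  hence "(1 / 3) ^ ?d * measure_pmf.prob ?M ?bad \<le> (2 / 3 :: real) ^ k"
    by (subst (asm) ennreal_le_iff) auto
  also have "\<dots> \<le> (2 / 3) ^ (4 * ?d)"
    by (rule power_decreasing) auto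
  also have "\<dots> = (1 / 3) ^ ?d * (16 / 27) ^ ?d"
    by (simp add: power_mult power_mult_distrib[symmetric] power4_eq_xxxx)
  finally have "measure_pmf.prob ?M ?bad \<le> (16 / 27) ^ ?d"
    by simp
  \<comment> \<open>\<open>k \<ge> 28\<close> gives \<open>?d \<ge> 7\<close>, the first exponent
    for which the power is below 0.04.\<close>
  also have "\<dots> \<le> (16 / 27) ^ 7"
    using assms(3) by (intro power_decreasing) auto
  also have "\<dots> \<le> (0.04 :: real)"
    by (simp add: power_divide)
  finally have "measure_pmf.prob ?M ?bad \<le> 0.04" .
  moreover have "measure_pmf.prob ?M ?bad = 1 - measure_pmf.prob ?M (UNIV - ?bad)"
    using measure_pmf.prob_compl[of "?bad" ?M] by simp
  moreover have "UNIV - ?bad = {f. ?d < ?T f}"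
    by auto
  ultimately show ?thesis
    by simp
qed

subsection \<open>Clustering the projected data\<close>

text \<open>Data are arbitrary families of functions, so that one notion covers the points, their
  centroids, their residuals and scalar projections.\<close>

definition deviation :: "nat set set \<Rightarrow> (nat \<Rightarrow> nat \<Rightarrow> real) \<Rightarrow> nat \<Rightarrow> nat \<Rightarrow> real" where
  "deviation S y i = (\<lambda>k. y i k - (\<Sum>j\<in>cluster_of S i. y j k) / real (card (cluster_of S i)))"

lemma cluster_of_partition:
  assumes "m_partition n m S" "i < n"
  shows "cluster_of S i \<in> S" "i \<in> cluster_of S i" "cluster_of S i \<subseteq> {..<n}"
    "finite (cluster_of S i)"
proof -
  have part: "partition_on {..<n} S"
    using assms(1) by (simp add: m_partition_def)
  have "\<exists>!C. C \<in> S \<and> i \<in> C"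
    using assms(2) part by (intro ex_ex1I) (auto simp: partition_on_def disjoint_def)
  hence "cluster_of S i \<in> S \<and> i \<in> cluster_of S i"
    unfolding cluster_of_def by (rule theI')
  thus "cluster_of S i \<in> S" "i \<in> cluster_of S i"
    by auto
  thus "cluster_of S i \<subseteq> {..<n}"
    using part by (auto simp: partition_on_def)
  thus "finite (cluster_of S i)"
    by (rule finite_subset) simp
qed

lemma sq_norm_vec_eq: "sq_norm_vec v = nrm2 (dim_vec v) (\<lambda>k. v $ k)"
  by (simp add: sq_norm_vec_def nrm2_def scalar_prod_def atLeast0LessThan power2_eq_square)

lemma kmeans_objective_eq:
  assumes "Y \<in> carrier_mat d n"
  shows "kmeans_objective Y S = (\<Sum>i<n. nrm2 d (deviation S (\<lambda>i k. Y $$ (k, i)) i))"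
  using assms unfolding kmeans_objective_def sq_norm_vec_eq
  by (auto simp: nrm2_def centroid_def deviation_def intro!: sum.cong)

text \<open>Linear functionals commute with averaging. On the right, the scalars form a data set
  with a dummy coordinate, read at 0.\<close>

lemma dotp_deviation:
  "dotp p w (deviation S y i) = deviation S (\<lambda>j (_::nat). dotp p w (y j)) i 0"
proof -
  let ?C = "cluster_of S i"
  have "dotp p w (\<lambda>k. (\<Sum>j\<in>?C. y j k) / real (card ?C)) = (\<Sum>j\<in>?C. dotp p w (y j)) / real (card ?C)"
    unfolding dotp_def
    by (simp add: sum_distrib_left sum_divide_distrib) (rule sum.swap)
  thus ?thesis
    by (simp add: deviation_def dotp_diff)
qed

text \<open>Averaging commutes with \<open>H\<close>, so the deviations of \<open>H * X\<close> are
  the images of those of \<open>X\<close>, and the projected objective sums one quadratic form over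
  the original deviations.\<close>

lemma kmeans_objective_mult:
  assumes H: "H \<in> carrier_mat q p" and X: "X \<in> carrier_mat p n" and S: "m_partition n m S"
  shows "kmeans_objective (H * X) S
    = (\<Sum>i<n. \<Sum>r<q. (dotp p (\<lambda>k. H $$ (r, k)) (deviation S (\<lambda>i k. X $$ (k, i)) i))\<^sup>2)"
proof -
  have HX: "(H * X) $$ (r, j) = dotp p (\<lambda>k. H $$ (r, k)) (\<lambda>k. X $$ (k, j))" if "r < q" "j < n" for r j
    using that H X by (auto simp: dotp_def scalar_prod_def atLeast0LessThan)
  have "deviation S (\<lambda>i k. (H * X) $$ (k, i)) i r
      = dotp p (\<lambda>k. H $$ (r, k)) (deviation S (\<lambda>i k. X $$ (k, i)) i)" if "i < n" "r < q" for i r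
  proof -
    have "(\<Sum>j\<in>cluster_of S i. (H * X) $$ (r, j))
        = (\<Sum>j\<in>cluster_of S i. dotp p (\<lambda>k. H $$ (r, k)) (\<lambda>k. X $$ (k, j)))"
      using cluster_of_partition(3)[OF S that(1)] that by (intro sum.cong refl HX) auto
    thus ?thesis
      unfolding dotp_deviation using that by (simp add: deviation_def HX)
  qed
  thus ?thesis
    using H X by (subst kmeans_objective_eq[of _ q n]) (auto simp: nrm2_def)
qed

text \<open>Cauchy-Schwarz bounds each squared centroid norm by the total sum. The crude factor in
  \<open>n\<close> is affordable because the final constants may depend on \<open>n\<close>.\<close>

lemma deviation_sum_le:
  assumes "m_partition n m S"
  shows "(\<Sum>i<n. nrm2 p (deviation S y i)) \<le> (2 + 2 * real n) * (\<Sum>i<n. nrm2 p (y i))"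
proof -
  let ?A = "\<Sum>j<n. nrm2 p (y j)"
  have "nrm2 p (deviation S y i) \<le> 2 * nrm2 p (y i) + 2 * ?A" if i: "i < n" for i
  proof -
    let ?C = "cluster_of S i"
    note C = cluster_of_partition[OF assms i]
    have card: "real (card ?C) \<ge> 1"
      using C by (simp add: Suc_le_eq card_gt_0_iff) blast
    have "((\<Sum>j\<in>?C. y j k) / real (card ?C))\<^sup>2 \<le> (\<Sum>j<n. (y j k)\<^sup>2)" for k
    proof -
      have "((\<Sum>j\<in>?C. y j k) / real (card ?C))\<^sup>2
          \<le> ((\<Sum>j\<in>?C. (y j k)\<^sup>2) * real (card ?C)) / (real (card ?C))\<^sup>2"
        unfolding power_divide by (intro divide_right_mono sum_squared_le_sum_of_squares) auto
      also have "\<dots> = (\<Sum>j\<in>?C. (y j k)\<^sup>2) / real (card ?C)"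
        by (simp add: power2_eq_square)
      also have "\<dots> \<le> (\<Sum>j\<in>?C. (y j k)\<^sup>2) / 1"
        using card by (intro divide_left_mono sum_nonneg) auto
      also have "\<dots> \<le> (\<Sum>j<n. (y j k)\<^sup>2)"
        using C by (simp add: sum_mono2)
      finally show ?thesis .
    qed
    hence "nrm2 p (\<lambda>k. (\<Sum>j\<in>?C. y j k) / real (card ?C)) \<le> (\<Sum>k<p. \<Sum>j<n. (y j k)\<^sup>2)"
      unfolding nrm2_def by (intro sum_mono)
    also have "\<dots> = ?A"
      unfolding nrm2_def by (rule sum.swap)
    finally have *: "nrm2 p (\<lambda>k. (\<Sum>j\<in>?C. y j k) / real (card ?C)) \<le> ?A" .
    have "nrm2 p (deviation S y i)
        \<le> 2 * nrm2 p (y i) + 2 * nrm2 p (\<lambda>k. (- 1) * ((\<Sum>j\<in>?C. y j k) / real (card ?C)))"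
      using nrm2_add_le[of p "y i" "\<lambda>k. (- 1) * ((\<Sum>j\<in>?C. y j k) / real (card ?C))"]
      by (simp add: deviation_def)
    thus ?thesis
      using * by (simp only: nrm2_scale) simp
  qed
  hence "(\<Sum>i<n. nrm2 p (deviation S y i)) \<le> (\<Sum>i<n. 2 * nrm2 p (y i) + 2 * ?A)"
    by (intro sum_mono) auto
  also have "\<dots> = (2 + 2 * real n) * ?A"
    by (simp add: sum.distrib sum_distrib_left[symmetric] algebra_simps)
  finally show ?thesis .
qed

text \<open>Only the centroid part of the data needs the lower bound on \<open>q\<close>, and that part lies in the
  span of the \<open>m\<close> centroids; the residuals are controlled by the upper bound alone.\<close>

lemma projected_clustering_near_optimal:
  fixes q :: "(nat \<Rightarrow> real) \<Rightarrow> real" and x :: "nat \<Rightarrow> nat \<Rightarrow> real"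
  assumes S: "m_partition n m S" and P: "m_partition n m P"
    and c: "c > 0" and \<gamma>: "\<gamma> \<ge> 0"
    and q_diff: "\<And>y z. q (\<lambda>k. y k - z k) \<le> 2 * q y + 2 * q z"
    and upper: "\<And>y. q y \<le> real p * nrm2 p y"
    and lower: "\<And>y. in_span p B y \<Longrightarrow> c * nrm2 p y \<le> q y"
    and B: "\<And>C. C \<in> P \<Longrightarrow> (\<lambda>k. (\<Sum>j\<in>C. x j k) / real (card C)) \<in> set B"
    and approx: "(\<Sum>i<n. q (deviation S x i)) \<le> \<gamma> * (\<Sum>i<n. q (deviation P x i))"
  shows "(\<Sum>i<n. nrm2 p (deviation S x i))
    \<le> (2 * (2 + 2 * real n) + (4 * \<gamma> * real p + 4 * real p * (2 + 2 * real n)) / c)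
      * (\<Sum>i<n. nrm2 p (deviation P x i))"
proof -
  define D where "D = 2 + 2 * real n"
  define \<mu> where "\<mu> i = (\<lambda>k. (\<Sum>j\<in>cluster_of P i. x j k) / real (card (cluster_of P i)))" for i
  define r where "r = deviation P x"
  define A where "A = (\<Sum>i<n. nrm2 p (r i))"
  \<comment> \<open>Each point is its \<open>P\<close>-centroid plus a residual, and the deviation
    with respect to \<open>S\<close> is linear in the data.\<close>
  have split: "deviation S x i = (\<lambda>k. deviation S \<mu> i k + deviation S r i k)" for i
  proof -
    have "x i = (\<lambda>k. \<mu> i k + r i k)" for i
      by (simp add: \<mu>_def r_def deviation_def)
    thus ?thesis
      by (simp add: deviation_def sum.distrib add_divide_distrib fun_eq_iff)
  qed
  have \<mu>B: "in_span p B (\<mu> i)" if "i < n" for i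
    unfolding \<mu>_def using that by (intro in_span_mem B cluster_of_partition(1)[OF P])
  have "in_span p B (deviation S \<mu> i)" if i: "i < n" for i
  proof -
    let ?C = "cluster_of S i"
    have "in_span p B (\<lambda>k. \<Sum>j\<in>?C. (1 / real (card ?C)) * \<mu> j k)"
      using cluster_of_partition[OF S i] by (intro in_span_sum \<mu>B) auto
    from in_span_add[OF \<mu>B[OF i] this, of "- 1"] show ?thesis
      by (simp add: deviation_def sum_divide_distrib)
  qed
  \<comment> \<open>The centroid part is the difference of the data and the residual part:
    \<open>approx\<close> controls \<open>q\<close> on the former and \<open>upper\<close> on the
    latter.\<close>
  hence "c * (\<Sum>i<n. nrm2 p (deviation S \<mu> i)) \<le> (\<Sum>i<n. q (deviation S \<mu> i))"
    unfolding sum_distrib_left by (intro sum_mono lower) auto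
  also have "\<dots> \<le> (\<Sum>i<n. 2 * q (deviation S x i) + 2 * q (deviation S r i))"
  proof (rule sum_mono)
    fix i
    show "q (deviation S \<mu> i) \<le> 2 * q (deviation S x i) + 2 * q (deviation S r i)"
      using q_diff[of "deviation S x i" "deviation S r i"] by (simp add: split)
  qed
  also have "\<dots> = 2 * (\<Sum>i<n. q (deviation S x i)) + 2 * (\<Sum>i<n. q (deviation S r i))"
    by (simp add: sum.distrib sum_distrib_left)
  also have "\<dots> \<le> 2 * (\<gamma> * (real p * A)) + 2 * (real p * (D * A))"
  proof -
    have "(\<Sum>i<n. q (deviation S x i)) \<le> \<gamma> * (\<Sum>i<n. q (r i))"
      using approx by (simp add: r_def)
    also have "\<dots> \<le> \<gamma> * (real p * A)"
      unfolding A_def sum_distrib_left[of "real p"] by (intro mult_left_mono sum_mono upper \<gamma>)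
    finally have 1: "(\<Sum>i<n. q (deviation S x i)) \<le> \<gamma> * (real p * A)" .
    have "(\<Sum>i<n. q (deviation S r i)) \<le> real p * (\<Sum>i<n. nrm2 p (deviation S r i))"
      unfolding sum_distrib_left by (intro sum_mono upper)
    also have "\<dots> \<le> real p * (D * A)"
      unfolding D_def A_def by (intro mult_left_mono deviation_sum_le[OF S]) simp
    finally show ?thesis
      using 1 by linarith
  qed
  finally have "(\<Sum>i<n. nrm2 p (deviation S \<mu> i)) \<le> (2 * (\<gamma> * (real p * A)) + 2 * (real p * (D * A))) / c"
    using c by (simp add: pos_le_divide_eq mult.commute)
  moreover have "(\<Sum>i<n. nrm2 p (deviation S x i))
      \<le> 2 * (\<Sum>i<n. nrm2 p (deviation S \<mu> i)) + 2 * (\<Sum>i<n. nrm2 p (deviation S r i))"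
    unfolding split sum_distrib_left sum.distrib[symmetric] by (intro sum_mono nrm2_add_le)
  moreover have "(\<Sum>i<n. nrm2 p (deviation S r i)) \<le> D * A"
    unfolding D_def A_def by (rule deviation_sum_le[OF S])
  ultimately have "(\<Sum>i<n. nrm2 p (deviation S x i))
      \<le> 2 * ((2 * (\<gamma> * (real p * A)) + 2 * (real p * (D * A))) / c) + 2 * (D * A)"
    by linarith
  also have "\<dots> = (2 * D + (4 * \<gamma> * real p + 4 * real p * D) / c) * A"
    using c by (simp add: field_simps)
  finally show ?thesis
    by (simp add: D_def A_def r_def)
qed

text \<open>Each point is matched with the centroid of its own cluster, and Cauchy-Schwarz over the
  \<open>n\<close> points turns the sum of square roots into the root of the objective. The absolute
  value covers either sign of \<open>\<eta>\<close>.\<close>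

lemma nystroem_error_kmeans:
  fixes \<Phi> :: "real vec \<Rightarrow> 'h :: real_inner"
  assumes \<Phi>: "is_feature_map p \<Phi> \<kappa>"
    and lip: "\<forall>a\<in>carrier_vec p. \<forall>b\<in>carrier_vec p. \<forall>c\<in>carrier_vec p. \<forall>d\<in>carrier_vec p.
         (\<kappa> a b - \<kappa> c d)\<^sup>2 \<le> \<eta> * (sq_norm_vec (a - c) + sq_norm_vec (b - d))"
    and X: "X \<in> carrier_mat p n" and L: "m_partition n m (set L)"
  shows "nystroem_error \<kappa> X (landmarks X L)
    \<le> 2 * sqrt (\<bar>\<eta>\<bar> * real n * kmeans_objective X (set L))"
proof -
  let ?s = "\<lambda>i. sq_norm_vec (col X i - centroid X (cluster_of (set L) i))"
  have "\<exists>j<length L. L ! j = cluster_of (set L) i" if "i < n" for i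
    using cluster_of_partition(1)[OF L that] by (simp add: in_set_conv_nth)
  then obtain c where c: "\<And>i. i < n \<Longrightarrow> c i < length L \<and> L ! c i = cluster_of (set L) i"
    by metis
  have Z: "landmarks X L \<in> carrier_mat p (length L)"
    using X by (auto simp: landmarks_def)
  have colZ: "col (landmarks X L) (c i) = centroid X (cluster_of (set L) i)" if "i < n" for i
    using c[OF that] X by (simp add: landmarks_def centroid_def)
  have s: "?s i \<ge> 0" for i
    by (simp add: sq_norm_vec_eq)
  have "nystroem_error \<kappa> X (landmarks X L)
      \<le> (\<Sum>i<n. 2 * sqrt (\<eta> * sq_norm_vec (col X i - col (landmarks X L) (c i))))"
    using c by (intro nystroem_error_le[OF \<Phi> lip X Z]) auto
  also have "\<dots> \<le> (\<Sum>i<n. 2 * sqrt (\<bar>\<eta>\<bar> * ?s i))"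
    by (intro sum_mono) (auto simp: colZ intro!: mult_right_mono s)
  also have "\<dots> = 2 * (\<Sum>i<n. sqrt (\<bar>\<eta>\<bar> * ?s i))"
    by (simp add: sum_distrib_left)
  also have "(\<Sum>i<n. sqrt (\<bar>\<eta>\<bar> * ?s i)) \<le> sqrt (\<bar>\<eta>\<bar> * real n * kmeans_objective X (set L))"
  proof (rule real_le_rsqrt)
    have "(\<Sum>i<n. sqrt (\<bar>\<eta>\<bar> * ?s i))\<^sup>2 \<le> (\<Sum>i<n. (sqrt (\<bar>\<eta>\<bar> * ?s i))\<^sup>2) * real (card {..<n})"
      by (rule sum_squared_le_sum_of_squares)
    also have "\<dots> = \<bar>\<eta>\<bar> * real n * kmeans_objective X (set L)"
      using X s by (simp add: kmeans_objective_def sum_distrib_left sum_distrib_right mult_ac)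
    finally show "(\<Sum>i<n. sqrt (\<bar>\<eta>\<bar> * ?s i))\<^sup>2 \<le> \<bar>\<eta>\<bar> * real n * kmeans_objective X (set L)" .
  qed
  finally show ?thesis by simp
qed

section \<open>Sign matrices and near-optimality after projection\<close>

lemma random_sign_matrix_eq:
  "random_sign_matrix p' p = map_pmf (mat p' p) (sign_pmf (1 / sqrt (real p')) ({..<p'} \<times> {..<p}))"
  by (simp add: random_sign_matrix_def sign_pmf_def)

lemma sign_pmf_sq:
  assumes "f \<in> set_pmf (sign_pmf a A)" "finite A" "x \<in> A"
  shows "(f x)\<^sup>2 = a\<^sup>2"
proof -
  have "f x \<in> {a, - a}"
    using assms by (cases x) (auto simp: sign_pmf_def set_Pi_pmf PiE_dflt_def)
  thus ?thesis by auto
qed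

lemma finite_m_partitions: "finite {S. m_partition n m S}"
proof (rule finite_subset)
  show "{S. m_partition n m S} \<subseteq> Pow (Pow {..<n})"
    by (auto simp: m_partition_def partition_on_def)
qed simp

text \<open>Each completed round yields \<open>nrm2 p y / (p' * pivot_const p ^ m)\<close> and there
  are at least \<open>p' / (8 * m)\<close> rounds, so \<open>p'\<close> cancels.\<close>

definition sign_const :: "nat \<Rightarrow> nat \<Rightarrow> real" where
  "sign_const p m = 1 / (8 * real m * pivot_const p ^ m)"

lemma sign_matrix_bounds:
  fixes f :: "nat \<times> nat \<Rightarrow> real"
  assumes f: "f \<in> set_pmf (sign_pmf (1 / sqrt (real p')) ({..<p'} \<times> {..<p}))"
    and m: "length B = m" "m \<ge> 1" and p': "p' \<ge> 8 * m"
    and T: "p' div 4 < snd (pivot_state p (1 / sqrt (real p')) B f p')"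
  shows "(\<Sum>r<p'. (dotp p (\<lambda>k. f (r, k)) y)\<^sup>2) \<le> real p * nrm2 p y"
    and "in_span p B y \<Longrightarrow> sign_const p m * nrm2 p y \<le> (\<Sum>r<p'. (dotp p (\<lambda>k. f (r, k)) y)\<^sup>2)"
proof -
  define a where "a = 1 / sqrt (real p')"
  have p'0: "real p' > 0"
    using p' m(2) by linarith
  have a: "a > 0" "a\<^sup>2 = 1 / real p'"
    using p'0 by (simp_all add: a_def power_divide)
  have row: "nrm2 p (\<lambda>k. f (r, k)) = real p * a\<^sup>2" if "r < p'" for r
    using sign_pmf_sq[OF f] that by (simp add: nrm2_def a_def)
  have "(\<Sum>r<p'. (dotp p (\<lambda>k. f (r, k)) y)\<^sup>2) \<le> (\<Sum>r<p'. real p * a\<^sup>2 * nrm2 p y)"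
    using dotp_sq_le[of p _ y] by (intro sum_mono) (simp add: row[symmetric])
  also have "\<dots> = real p * nrm2 p y"
    using p'0 by (simp add: a(2))
  finally show "(\<Sum>r<p'. (dotp p (\<lambda>k. f (r, k)) y)\<^sup>2) \<le> real p * nrm2 p y" .
  show "sign_const p m * nrm2 p y \<le> (\<Sum>r<p'. (dotp p (\<lambda>k. f (r, k)) y)\<^sup>2)" if y: "in_span p B y"
  proof -
    let ?T = "snd (pivot_state p a B f p')"
    \<comment> \<open>Rounding to completed rounds costs at most \<open>4 * m\<close> in the bound
      on \<open>p'\<close>, which is at most half of \<open>p'\<close>.\<close>
    have "real p' / (8 * real m) \<le> real (?T div m)"
    proof -
      have 1: "p' < 4 * ?T"
        using T by (simp add: a_def)
      have "?T < m * (?T div m + 1)"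
        using m(2) by (simp add: dividend_less_times_div)
      hence "p' < 4 * (m * (?T div m + 1))"
        using 1 by linarith
      hence "real p' < real (4 * (m * (?T div m + 1)))"
        by (simp only: of_nat_less_iff)
      moreover have "real p' \<ge> 8 * real m"
        using p' by linarith
      ultimately have "real p' \<le> 8 * real m * real (?T div m)"
        by (simp add: algebra_simps)
      thus ?thesis
        using m(2) by (simp add: divide_le_eq mult.commute)
    qed
    hence "a\<^sup>2 * nrm2 p y / pivot_const p ^ m * (real p' / (8 * real m))
        \<le> a\<^sup>2 * nrm2 p y / pivot_const p ^ m * real (?T div m)"
      using pivot_const_ge[of p] by (intro mult_left_mono divide_nonneg_nonneg) auto
    also have "\<dots> \<le> (\<Sum>r<p'. (dotp p (\<lambda>k. f (r, k)) y)\<^sup>2)"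
      unfolding m(1)[symmetric] using m y row by (intro span_lower_bound a) auto
    finally show ?thesis
      using p'0 by (simp add: a(2) sign_const_def mult.commute)
  qed
qed

text \<open>The squared norm of the projection serves as the form \<open>q\<close>, and the
  centroids of the comparison partition \<open>Ol\<close> serve as the spanning list.\<close>

lemma sign_matrix_near_optimal:
  fixes f :: "nat \<times> nat \<Rightarrow> real"
  assumes X: "X \<in> carrier_mat p n" and P: "m_partition n m (set Ol)" "distinct Ol"
    and S: "m_partition n m S" and m: "m \<ge> 1" and p': "p' \<ge> 8 * m" and \<gamma>: "\<gamma> \<ge> 1"
    and f: "f \<in> set_pmf (sign_pmf (1 / sqrt (real p')) ({..<p'} \<times> {..<p}))"
    and T: "p' div 4 < snd (pivot_state p (1 / sqrt (real p'))
      (map (\<lambda>C k. (\<Sum>j\<in>C. X $$ (k, j)) / real (card C)) Ol) f p')"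
    and approx: "kmeans_objective (mat p' p f * X) S
      \<le> \<gamma> * Min (kmeans_objective (mat p' p f * X) ` {S. m_partition n m S})"
  shows "kmeans_objective X S
    \<le> (2 * (2 + 2 * real n) + (4 * \<gamma> * real p + 4 * real p * (2 + 2 * real n)) / sign_const p m)
      * kmeans_objective X (set Ol)"
proof -
  let ?B = "map (\<lambda>C k. (\<Sum>j\<in>C. X $$ (k, j)) / real (card C)) Ol"
  let ?x = "\<lambda>i k. X $$ (k, i)"
  define q where "q y = (\<Sum>r<p'. (dotp p (\<lambda>k. f (r, k)) y)\<^sup>2)" for y
  have len: "length ?B = m"
    using P by (simp add: m_partition_def distinct_card)
  note bounds = sign_matrix_bounds[OF f len m p' T]
  have q: "kmeans_objective (mat p' p f * X) R = (\<Sum>i<n. q (deviation R ?x i))"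
    if "m_partition n m R" for R
  proof -
    have "dotp p (\<lambda>k. mat p' p f $$ (r, k)) y = dotp p (\<lambda>k. f (r, k)) y" if "r < p'" for r y
      using that by (simp add: dotp_def)
    thus ?thesis
      using X that by (subst kmeans_objective_mult[of _ p' p _ n m]) (auto simp: q_def)
  qed
  \<comment> \<open>The comparison partition is itself a candidate for the projected
    minimum.\<close>
  have "Min (kmeans_objective (mat p' p f * X) ` {S. m_partition n m S})
      \<le> kmeans_objective (mat p' p f * X) (set Ol)"
    using P finite_m_partitions by (intro Min_le) auto
  hence "kmeans_objective (mat p' p f * X) S \<le> \<gamma> * kmeans_objective (mat p' p f * X) (set Ol)"
    using approx \<gamma> by (meson mult_left_mono order_trans zero_le_one)
  hence "(\<Sum>i<n. q (deviation S ?x i)) \<le> \<gamma> * (\<Sum>i<n. q (deviation (set Ol) ?x i))"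
    by (simp add: q S P)
  moreover have "q (\<lambda>k. y k - z k) \<le> 2 * q y + 2 * q z" for y z
  proof -
    have "(s - t)\<^sup>2 \<le> 2 * s\<^sup>2 + 2 * t\<^sup>2" for s t :: real
      using sum_squares_bound[of s "- t"] by (simp add: power2_diff)
    thus ?thesis
      unfolding q_def dotp_diff sum_distrib_left sum.distrib[symmetric] by (intro sum_mono)
  qed
  moreover have "sign_const p m > 0"
    using m pivot_const_ge[of p] by (auto simp: sign_const_def intro!: mult_pos_pos)
  ultimately show ?thesis
    unfolding kmeans_objective_eq[OF X] using S P(1) bounds \<gamma>
    by (intro projected_clustering_near_optimal[where q = q and B = ?B]) (auto simp: q_def)
qed

theorem theorem2:
  shows "\<exists>c0::real. c0 > 0 \<and>
    (\<forall>(p::nat) (n::nat) (m::nat) (\<kappa> :: real vec \<Rightarrow> real vec \<Rightarrow> real)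
      (\<Phi> :: real vec \<Rightarrow> 'h :: real_inner) (\<eta>::real) (\<gamma>::real).
      1 \<le> m \<and> m \<le> n \<and> 1 \<le> \<gamma> \<and>
      is_feature_map p \<Phi> \<kappa> \<and>
      (\<forall>a\<in>carrier_vec p. \<forall>b\<in>carrier_vec p. \<forall>c\<in>carrier_vec p. \<forall>d\<in>carrier_vec p.
         (\<kappa> a b - \<kappa> c d)\<^sup>2 \<le> \<eta> * (sq_norm_vec (a - c) + sq_norm_vec (b - d))) \<longrightarrow>
      (\<exists>\<eta>1 \<eta>2 :: real. \<eta>1 > 0 \<and> \<eta>2 > 0 \<and>
        (\<forall>(X :: real mat) (Sopt :: nat set set) (\<epsilon>::real) (p'::nat)
          (Shat :: real mat \<Rightarrow> nat set list).
          X \<in> carrier_mat p n \<and>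
          is_arg_min (kmeans_objective X) (m_partition n m) Sopt \<and>
          0 < \<epsilon> \<and> \<epsilon> < 1 / 3 \<and>
          real p' \<ge> c0 * real m / \<epsilon>\<^sup>2 \<and>
          (\<forall>H\<in>set_pmf (random_sign_matrix p' p).
             distinct (Shat H) \<and> m_partition n m (set (Shat H)) \<and>
             kmeans_objective (H * X) (set (Shat H))
               \<le> \<gamma> * Min (kmeans_objective (H * X) ` {S. m_partition n m S})) \<longrightarrow>
          measure_pmf.prob (random_sign_matrix p' p)
            {H. nystroem_error \<kappa> X (landmarks X (Shat H))
                  \<le> \<eta>1 * sqrt ((2 + \<epsilon>) * kmeans_objective X Sopt)
                    + \<eta>2 * ((2 + \<epsilon>) * kmeans_objective X Sopt)}
            \<ge> 0.96)))"
\<comment> \<open>Since \<open>\<epsilon> < 1 / 3\<close>, the value 4 gives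
  \<open>p' \<ge> 36 * m\<close>, which covers both \<open>8 * m\<close> for counting rounds and 28
  for the probability bound.\<close>
proof (rule exI[of _ 4], intro conjI allI impI)
  fix p n m :: nat and \<kappa> :: "real vec \<Rightarrow> real vec \<Rightarrow> real"
    and \<Phi> :: "real vec \<Rightarrow> 'h :: real_inner" and \<eta> \<gamma> :: real
  assume "1 \<le> m \<and> m \<le> n \<and> 1 \<le> \<gamma> \<and> is_feature_map p \<Phi> \<kappa> \<and>
      (\<forall>a\<in>carrier_vec p. \<forall>b\<in>carrier_vec p. \<forall>c\<in>carrier_vec p. \<forall>d\<in>carrier_vec p.
         (\<kappa> a b - \<kappa> c d)\<^sup>2 \<le> \<eta> * (sq_norm_vec (a - c) + sq_norm_vec (b - d)))"
  hence m: "1 \<le> m" and \<gamma>: "1 \<le> \<gamma>" and \<Phi>: "is_feature_map p \<Phi> \<kappa>"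
    and lip: "\<forall>a\<in>carrier_vec p. \<forall>b\<in>carrier_vec p. \<forall>c\<in>carrier_vec p. \<forall>d\<in>carrier_vec p.
         (\<kappa> a b - \<kappa> c d)\<^sup>2 \<le> \<eta> * (sq_norm_vec (a - c) + sq_norm_vec (b - d))"
    by auto
  \<comment> \<open>The near-optimality factor depends on \<open>p\<close>, \<open>n\<close>,
    \<open>m\<close> and \<open>\<gamma>\<close> only, so it can be fixed before \<open>X\<close>,
    \<open>\<epsilon>\<close> and \<open>p'\<close>.\<close>
  define R where
    "R = 2 * (2 + 2 * real n) + (4 * \<gamma> * real p + 4 * real p * (2 + 2 * real n)) / sign_const p m"
  have R: "R \<ge> 0"
    using \<gamma> pivot_const_ge[of p] by (simp add: R_def sign_const_def)
  \<comment> \<open>The summand 1 keeps \<open>\<eta>1\<close> positive even if the root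
    vanishes.\<close>
  define \<eta>1 where "\<eta>1 = 2 * sqrt (\<bar>\<eta>\<bar> * real n * R) + 1"
  have \<eta>1: "\<eta>1 > 0"
    using R by (auto simp: \<eta>1_def intro!: add_nonneg_pos)
  show "\<exists>\<eta>1 \<eta>2 :: real. \<eta>1 > 0 \<and> \<eta>2 > 0 \<and>
        (\<forall>(X :: real mat) (Sopt :: nat set set) (\<epsilon>::real) (p'::nat)
          (Shat :: real mat \<Rightarrow> nat set list).
          X \<in> carrier_mat p n \<and>
          is_arg_min (kmeans_objective X) (m_partition n m) Sopt \<and>
          0 < \<epsilon> \<and> \<epsilon> < 1 / 3 \<and>
          real p' \<ge> 4 * real m / \<epsilon>\<^sup>2 \<and>
          (\<forall>H\<in>set_pmf (random_sign_matrix p' p).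
             distinct (Shat H) \<and> m_partition n m (set (Shat H)) \<and>
             kmeans_objective (H * X) (set (Shat H))
               \<le> \<gamma> * Min (kmeans_objective (H * X) ` {S. m_partition n m S})) \<longrightarrow>
          measure_pmf.prob (random_sign_matrix p' p)
            {H. nystroem_error \<kappa> X (landmarks X (Shat H))
                  \<le> \<eta>1 * sqrt ((2 + \<epsilon>) * kmeans_objective X Sopt)
                    + \<eta>2 * ((2 + \<epsilon>) * kmeans_objective X Sopt)}
            \<ge> 0.96)"
  \<comment> \<open>The square-root term alone dominates the error, so any positive number can serve
    as \<open>\<eta>2\<close>.\<close>
  proof (rule exI[of _ \<eta>1], rule exI[of _ 1], intro conjI allI impI \<eta>1)
    fix X :: "real mat" and Sopt :: "nat set set" and \<epsilon> :: real and p' :: nat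
      and Shat :: "real mat \<Rightarrow> nat set list"
    let ?M = "random_sign_matrix p' p"
    assume "X \<in> carrier_mat p n \<and>
          is_arg_min (kmeans_objective X) (m_partition n m) Sopt \<and>
          0 < \<epsilon> \<and> \<epsilon> < 1 / 3 \<and>
          real p' \<ge> 4 * real m / \<epsilon>\<^sup>2 \<and>
          (\<forall>H\<in>set_pmf ?M.
             distinct (Shat H) \<and> m_partition n m (set (Shat H)) \<and>
             kmeans_objective (H * X) (set (Shat H))
               \<le> \<gamma> * Min (kmeans_objective (H * X) ` {S. m_partition n m S}))"
    hence X: "X \<in> carrier_mat p n" and Sopt: "m_partition n m Sopt"
      and \<epsilon>: "0 < \<epsilon>" "\<epsilon> < 1 / 3" and p'_ge: "real p' \<ge> 4 * real m / \<epsilon>\<^sup>2"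
      and Shat: "\<And>H. H \<in> set_pmf ?M \<Longrightarrow> m_partition n m (set (Shat H))"
        "\<And>H. H \<in> set_pmf ?M \<Longrightarrow> kmeans_objective (H * X) (set (Shat H))
               \<le> \<gamma> * Min (kmeans_objective (H * X) ` {S. m_partition n m S})"
      by (auto simp: is_arg_min_def)
    let ?E = "kmeans_objective X Sopt"
    let ?good = "{H. nystroem_error \<kappa> X (landmarks X (Shat H))
                  \<le> \<eta>1 * sqrt ((2 + \<epsilon>) * ?E) + 1 * ((2 + \<epsilon>) * ?E)}"
    have "real p' \<ge> 36 * real m"
    proof -
      have "\<epsilon>\<^sup>2 \<le> (1 / 3)\<^sup>2"
        using \<epsilon> by (intro power_mono) auto
      hence "4 * real m / (1 / 9) \<le> 4 * real m / \<epsilon>\<^sup>2"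
        using \<epsilon> by (intro divide_left_mono) (auto simp: power2_eq_square)
      thus ?thesis
        using p'_ge by simp
    qed
    hence p'_m: "p' \<ge> 36 * m"
      by linarith
    hence p': "p' \<ge> 8 * m" "p' \<ge> 28" "p' > 0"
      using m by linarith+
    obtain Ol where Ol: "set Ol = Sopt" "distinct Ol"
      using Sopt finite_distinct_list[of Sopt] finite_elements[of "{..<n}" Sopt]
      by (auto simp: m_partition_def)
    have E0: "?E \<ge> 0"
      by (simp add: kmeans_objective_eq[OF X] sum_nonneg)
    let ?a = "1 / sqrt (real p')"
    \<comment> \<open>These centroids come from \<open>X\<close> alone, so the list is fixed before
      the signs are drawn and the pivot probability applies to it.\<close>
    let ?B = "map (\<lambda>C k. (\<Sum>j\<in>C. X $$ (k, j)) / real (card C)) Ol"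
    let ?N = "sign_pmf ?a ({..<p'} \<times> {..<p})"
    have B: "?B \<noteq> []"
      using Ol Sopt m by (auto simp: m_partition_def)
    have good: "mat p' p f \<in> ?good"
      if f: "f \<in> set_pmf ?N" and T: "p' div 4 < snd (pivot_state p ?a ?B f p')" for f
    proof -
      let ?H = "mat p' p f"
      let ?S = "set (Shat ?H)"
      have H: "?H \<in> set_pmf ?M"
        using f by (auto simp: random_sign_matrix_eq)
      have "kmeans_objective X ?S \<le> R * ?E"
        using sign_matrix_near_optimal[OF X _ Ol(2) Shat(1)[OF H] m p'(1) \<gamma> f T Shat(2)[OF H]]
          Sopt by (simp add: R_def Ol(1))
      hence "\<bar>\<eta>\<bar> * real n * kmeans_objective X ?S \<le> \<bar>\<eta>\<bar> * real n * (R * ?E)"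
        by (intro mult_left_mono) auto
      hence "2 * sqrt (\<bar>\<eta>\<bar> * real n * kmeans_objective X ?S) \<le> 2 * sqrt (\<bar>\<eta>\<bar> * real n * R) * sqrt ?E"
        by (simp add: real_sqrt_mult[symmetric] mult.assoc)
      also have "\<dots> \<le> \<eta>1 * sqrt ((2 + \<epsilon>) * ?E)"
      proof (intro mult_mono)
        show "sqrt ?E \<le> sqrt ((2 + \<epsilon>) * ?E)"
          using E0 \<epsilon> mult_right_mono[of 1 "2 + \<epsilon>" ?E] by simp
      qed (use \<eta>1 E0 in \<open>auto simp: \<eta>1_def\<close>)
      also have "\<dots> \<le> \<eta>1 * sqrt ((2 + \<epsilon>) * ?E) + 1 * ((2 + \<epsilon>) * ?E)"
        using E0 \<epsilon> by simp
      finally show ?thesis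
        using nystroem_error_kmeans[OF \<Phi> lip X Shat(1)[OF H]] by simp
    qed
    have "0.96 \<le> measure_pmf.prob ?N {f. p' div 4 < snd (pivot_state p ?a ?B f p')}"
      using p' B by (intro pivot_count_probability) auto
    \<comment> \<open>The inclusion holds almost surely: \<open>Shat\<close> is constrained only on
      the support of the matrix law.\<close>
    also have "\<dots> \<le> measure_pmf.prob ?N (mat p' p -` ?good)"
      using good by (intro measure_pmf.finite_measure_mono_AE) (auto simp: AE_measure_pmf_iff)
    also have "\<dots> = measure_pmf.prob ?M ?good"
      by (simp add: random_sign_matrix_eq)
    finally show "measure_pmf.prob ?M ?good \<ge> 0.96" .
  qed simp
qed simp

end
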